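(* For every $c,n>1$, every pseudo-deterministic streaming algorithm that $c$-approximates the number of items in a stream of length at most $(c+1)n$ must use $\Omega_c\big(\sqrt{\log n/\log\log n}\big)$ bits of space.
   Context: A streaming algorithm $A$ reads a stream (a finite sequence of items) in one sequential pass, using limited memory measured in bits, and produces an output at the end. $A$ is pseudo-deterministic (PD) if there is a function $F$ defined on all input streams (its canonical function) such that for every stream $\sigma$, $\Pr[A(\sigma)=F(\sigma)]\ge 9/10$, the probability being over the algorithm's random choices. "$c$-approximates the number of items" refers to multiplicative approximation: the output is within a factor $c$ of the number of items in the stream. The notation $\Omega_c(\cdot)$ hides factors polynomial in $c$. *)

theory Defs
  imports "HOL-Probability.Probability"
begin

text \<open>
  A randomized one-pass streaming algorithm over items of type \<open>'a\<close>. The memory contents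
  between two items are a bit string; initialization, update and output may all use fresh
  randomness. Random bits are not charged for as such, but anything remembered from one item
  to the next (including the current position in the stream) has to be stored in the memory.
  The algorithm need not be uniform or computable.
\<close>

record 'a streaming_algorithm =
  init_memory :: "bool list pmf"
  update_memory :: "bool list \<Rightarrow> 'a \<Rightarrow> bool list pmf"
  read_output :: "bool list \<Rightarrow> real pmf"

definition memory_after :: "'a streaming_algorithm \<Rightarrow> 'a list \<Rightarrow> bool list pmf" where
  "memory_after A \<sigma> =
     foldl (\<lambda>M x. bind_pmf M (\<lambda>m. update_memory A m x)) (init_memory A) \<sigma>"

definition output_of :: "'a streaming_algorithm \<Rightarrow> 'a list \<Rightarrow> real pmf" where
  "output_of A \<sigma> = bind_pmf (memory_after A \<sigma>) (read_output A)"

definition streams_upto :: "real \<Rightarrow> 'a list set" where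
  "streams_upto L = {\<sigma>. real (length \<sigma>) \<le> L}"

text \<open>Worst-case space: the bound holds on every input stream and for all random choices.\<close>

definition uses_space :: "'a streaming_algorithm \<Rightarrow> 'a list set \<Rightarrow> nat \<Rightarrow> bool" where
  "uses_space A D s \<longleftrightarrow> (\<forall>\<sigma>\<in>D. \<forall>m\<in>set_pmf (memory_after A \<sigma>). length m \<le> s)"

definition pseudo_deterministic :: "'a streaming_algorithm \<Rightarrow> 'a list set \<Rightarrow> bool" where
  "pseudo_deterministic A D \<longleftrightarrow>
     (\<exists>F :: 'a list \<Rightarrow> real. \<forall>\<sigma>\<in>D. measure_pmf.prob (output_of A \<sigma>) {F \<sigma>} \<ge> 9 / 10)"

definition within_factor :: "real \<Rightarrow> real \<Rightarrow> real \<Rightarrow> bool" where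
  "within_factor c N y \<longleftrightarrow> N / c \<le> y \<and> y \<le> c * N"

text \<open>
  For a pseudo-deterministic algorithm this is equivalent to the canonical output being within
  a factor \<open>c\<close> of the number of items on every input stream, because two events of probability
  at least \<open>9 / 10\<close> intersect (see below).
\<close>

definition approximates_count :: "'a streaming_algorithm \<Rightarrow> 'a list set \<Rightarrow> real \<Rightarrow> bool" where
  "approximates_count A D c \<longleftrightarrow>
     (\<forall>\<sigma>\<in>D. measure_pmf.prob (output_of A \<sigma>) {y. within_factor c (real (length \<sigma>)) y} \<ge> 9 / 10)"

lemma approximates_count_iff_canonical:
  assumes F: "\<And>\<sigma>. \<sigma> \<in> D \<Longrightarrow> measure_pmf.prob (output_of A \<sigma>) {F \<sigma>} \<ge> 9 / 10"
  shows "approximates_count A D c \<longleftrightarrow> (\<forall>\<sigma>\<in>D. within_factor c (real (length \<sigma>)) (F \<sigma>))"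
proof -
  have "measure_pmf.prob (output_of A \<sigma>) S \<ge> 9 / 10 \<longleftrightarrow> F \<sigma> \<in> S" if "\<sigma> \<in> D" for \<sigma> S
  proof
    assume "F \<sigma> \<in> S"
    then have "measure_pmf.prob (output_of A \<sigma>) {F \<sigma>} \<le> measure_pmf.prob (output_of A \<sigma>) S"
      by (intro measure_pmf.finite_measure_mono) auto
    with F[OF that] show "measure_pmf.prob (output_of A \<sigma>) S \<ge> 9 / 10" by linarith
  next
    assume S: "measure_pmf.prob (output_of A \<sigma>) S \<ge> 9 / 10"
    show "F \<sigma> \<in> S"
    proof (rule ccontr)
      assume "F \<sigma> \<notin> S"
      then have "measure_pmf.prob (output_of A \<sigma>) (S \<union> {F \<sigma>}) =
          measure_pmf.prob (output_of A \<sigma>) S + measure_pmf.prob (output_of A \<sigma>) {F \<sigma>}"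
        by (intro measure_pmf.finite_measure_Union) auto
      moreover have "measure_pmf.prob (output_of A \<sigma>) (S \<union> {F \<sigma>}) \<le> 1"
        by (rule measure_pmf.prob_le_1)
      ultimately show False using S F[OF that] by linarith
    qed
  qed
  then show ?thesis unfolding approximates_count_def by simp
qed

end

theory Submission
  imports Defs "HOL-Number_Theory.Cong"
begin

text \<open>
  Feed the algorithm copies of one item, so that its memory is a time-homogeneous Markov chain
  on fewer than \<open>2 ^ (s + 1)\<close> states. Let \<open>f t\<close> say whether the canonical output after \<open>t\<close> items
  is at least \<open>n / c\<close>; it fails for \<open>t < n / c\<^sup>2\<close> and holds for \<open>t \<ge> n\<close>, and the
  probability \<open>p(t)\<close> that the output is at least \<open>n / c\<close> never lies strictly between \<open>1 / 10\<close>
  and \<open>9 / 10\<close>.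

  Weight each path by the fraction of its first \<open>N\<close> steps spent at a state \<open>y\<close>. For a state with
  a likely return time \<open>l = 2 ^ O(s)\<close>, inserting one loop of length \<open>l\<close> hardly changes the
  weighted path measure (a martingale fluctuation of order \<open>1 / sqrt N\<close>), and the other states
  are rarely visited. So on windows of length \<open>W = 2 ^ O(s\<^sup>2)\<close> beyond time \<open>N\<close>, \<open>p\<close> is nearly a
  mixture of functions of period \<open>2 ^ O(s)\<close>.

  Sliding the window from the region where \<open>f\<close> fails to the region where it holds, some window
  contains exactly a prescribed small fraction \<open>2 ^ (- O(s))\<close> of points with \<open>f\<close>. There, replace
  the mixture by the sum \<open>H\<close> of \<open>O(s)\<close> sampled components: \<open>H\<close> is high where \<open>f\<close> holds, low where it
  fails, and its value is intermediate only on an exponentially smaller fraction of the points.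
  But the joint period of the sample is at most \<open>W\<close>, and up to a small modulus \<open>Q\<close> one can move
  from any residue to any other by few steps that each affect few components. Such a path from
  a high to a low value of \<open>H\<close> passes through an intermediate one, so intermediate values cannot
  be that rare. Hence \<open>n\<close> is at most \<open>c\<^sup>2 * 2 ^ O(s\<^sup>2)\<close>.
\<close>

section \<open>Sums of periodic functions\<close>

text \<open>Greedy choice: an element of \<open>X\<close> not divisible by the current gcd replaces
  it by a proper divisor, hence at least halves it. Starting from \<open>q\<close>, at most log2
  \<open>q\<close> elements are picked. This will bound the number of legs of a path between
  residues.\<close>

lemma short_list_same_Gcd:
  fixes q :: nat and X :: "nat set"
  assumes q: "q > 0"
  shows "\<exists>ms. set ms \<subseteq> X \<and> Gcd (insert q (set ms)) = Gcd (insert q X) \<and> 2 ^ length ms \<le> q"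
proof -
  have "\<exists>ms. set ms \<subseteq> X \<and> Gcd (insert q (set ms)) = Gcd (insert q X) \<and> 2 ^ length ms \<le> q"
    if "g = Gcd (insert q (set ms))" "set ms \<subseteq> X" "2 ^ length ms * g \<le> q" for g ms
    using that
  proof (induction g arbitrary: ms rule: less_induct)
    case (less g)
    have gpos: "g > 0" using less.prems(1) q by (metis Gcd_dvd dvd_pos_nat insertI1)
    show ?case
    proof (cases "\<forall>M\<in>X. g dvd M")
      case True
      have "g dvd q" using less.prems(1) by simp
      then have "g dvd Gcd (insert q X)" using True by (auto intro!: Gcd_greatest)
      moreover have "Gcd (insert q X) dvd g"
        unfolding less.prems(1) by (rule Gcd_greatest) (rule Gcd_dvd, use less.prems(2) in blast)
      ultimately have "Gcd (insert q X) = g" by (simp add: dvd_antisym)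
      moreover have "2 ^ length ms \<le> q"
        using less.prems(3) gpos by (metis dual_order.trans less_one linorder_not_less mult.right_neutral mult_le_mono2)
      ultimately show ?thesis using less.prems(1,2) by (intro exI[of _ ms] conjI) simp_all
    next
      case False
      then obtain M where M: "M \<in> X" "\<not> g dvd M" by blast
      define g' where "g' = gcd g M"
      have "g' dvd g" "g' \<noteq> g" unfolding g'_def using M(2) by (metis gcd_dvd1, metis gcd_dvd2)
      then obtain t where t: "g = g' * t" "t \<noteq> 1" by auto
      then have "t \<ge> 2" using gpos by (cases t) auto
      then have le: "2 * g' \<le> g" using t by (simp add: mult.commute)
      have "g' = Gcd (insert q (set (M # ms)))"
        unfolding g'_def less.prems(1) by (simp add: gcd.left_commute gcd.commute)
      moreover have "g' < g" using le gpos by linarith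
      moreover have "2 ^ length (M # ms) * g' \<le> q"
      proof -
        have "2 ^ length (M # ms) * g' = 2 ^ length ms * (2 * g')" by simp
        also have "\<dots> \<le> 2 ^ length ms * g" by (rule mult_le_mono2[OF le])
        finally show ?thesis using less.prems(3) by linarith
      qed
      ultimately show ?thesis using less.IH[of g' "M # ms"] M less.prems(2) by auto
    qed
  qed
  from this[of q "[]"] show ?thesis by simp
qed

lemma multiplicity_prod_list:
  fixes p :: nat
  assumes "prime p" "\<And>l. l \<in> set ls \<Longrightarrow> l > 0"
  shows "multiplicity p (prod_list ls) = (\<Sum>l\<leftarrow>ls. multiplicity p l)"
  using assms(2)
proof (induction ls)
  case (Cons a ls)
  have "prod_list ls \<noteq> 0" using Cons.prems by (metis list.set_intros(2) less_irrefl prod_list_zero_iff)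
  then show ?case using Cons assms(1)
    by (simp add: prime_elem_multiplicity_mult_distrib)
qed auto

lemma sum_list_ge_threshold_count:
  fixes f :: "'b \<Rightarrow> nat"
  shows "h * length (filter (\<lambda>l. h \<le> f l) ls) \<le> (\<Sum>l\<leftarrow>ls. f l)"
  by (induction ls) auto

lemma filter_length_mono:
  "(\<And>x. x \<in> set xs \<Longrightarrow> P x \<Longrightarrow> Q x) \<Longrightarrow> length (filter P xs) \<le> length (filter Q xs)"
  by (induction xs) auto

text \<open>
  Shifting by a multiple of a move keeps the residues modulo all but at most \<open>k\<close> of the given
  numbers. The gcd \<open>Q\<close> of all moves is small: a prime power dividing it must divide more than
  \<open>k\<close> of the numbers.
\<close>

definition moves :: "nat \<Rightarrow> nat list \<Rightarrow> nat set" where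
  "moves k ls = {M. M dvd prod_list ls \<and> length (filter (\<lambda>l. \<not> l dvd M) ls) \<le> k}"

lemma Gcd_moves_power_dvd:
  assumes pos: "\<And>l. l \<in> set ls \<Longrightarrow> l > 0"
  shows "Gcd (moves k ls) ^ Suc k dvd prod_list ls"
proof -
  define q where "q = prod_list ls"
  define Q where "Q = Gcd (moves k ls)"
  have q0: "q > 0" unfolding q_def using pos by (metis not_gr_zero prod_list_zero_iff)
  have ldvd: "l dvd q" if "l \<in> set ls" for l
    using that unfolding q_def by (rule prod_list_dvd)
  have "q \<in> moves k ls"
    unfolding moves_def using ldvd by (auto simp: q_def filter_empty_conv)
  then have "Q dvd q" unfolding Q_def by (rule Gcd_dvd)
  then have Q0: "Q > 0" using q0 by (auto intro: Nat.gr0I)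
  have "Q ^ Suc k dvd q"
  proof (rule multiplicity_le_imp_dvd)
    show "Q ^ Suc k \<noteq> 0" using Q0 by simp
    fix p :: nat assume p: "prime p"
    define h where "h = multiplicity p Q"
    define e where "e = multiplicity p q"
    have he: "h \<le> e" unfolding h_def e_def using \<open>Q dvd q\<close> q0 by (intro dvd_imp_multiplicity_le) auto
    \<comment> \<open>If at most \<open>k\<close> of the numbers had valuation at least
      \<open>h\<close> at \<open>p\<close>, removing \<open>e - h + 1\<close> factors
      \<open>p\<close> from \<open>q\<close> would leave a move \<open>M\<close> of valuation
      \<open>h - 1\<close>, which \<open>Q\<close> could not divide.\<close>
    have cnt: "Suc k \<le> length (filter (\<lambda>l. h \<le> multiplicity p l) ls)" if h: "h > 0"
    proof (rule ccontr)
      assume "\<not> ?thesis"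
      then have small: "length (filter (\<lambda>l. h \<le> multiplicity p l) ls) \<le> k" by simp
      have "p ^ (e - h + 1) dvd q"
        using h he by (intro multiplicity_dvd') (auto simp: e_def)
      then obtain M where M: "q = p ^ (e - h + 1) * M" by blast
      have M0: "M > 0" using q0 M by (auto intro: Nat.gr0I)
      have "multiplicity p q = multiplicity p (p ^ (e - h + 1)) + multiplicity p M"
        by (subst M, rule prime_elem_multiplicity_mult_distrib) (use p M0 in auto)
      also have "multiplicity p (p ^ (e - h + 1)) = e - h + 1"
        using p by (intro multiplicity_same_power) auto
      finally have "e = (e - h + 1) + multiplicity p M" unfolding e_def .
      then have mM: "multiplicity p M = h - 1" using h he by linarith
      have "l dvd M" if l: "l \<in> set ls" "\<not> h \<le> multiplicity p l" for l
      proof (rule multiplicity_le_imp_dvd)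
        show "l \<noteq> 0" using pos l by auto
        fix r :: nat assume r: "prime r"
        show "multiplicity r l \<le> multiplicity r M"
        proof (cases "r = p")
          case True then show ?thesis using l mM by simp
        next
          case False
          have "multiplicity r l \<le> multiplicity r q"
            using ldvd[OF l(1)] q0 by (intro dvd_imp_multiplicity_le) auto
          also have "\<dots> = multiplicity r (p ^ (e - h + 1)) + multiplicity r M"
            by (subst M, rule prime_elem_multiplicity_mult_distrib) (use r p M0 in auto)
          also have "multiplicity r (p ^ (e - h + 1)) = 0"
            using r p False by (metis multiplicity_distinct_prime_power)
          finally show ?thesis by simp
        qed
      qed
      then have "length (filter (\<lambda>l. \<not> l dvd M) ls) \<le> length (filter (\<lambda>l. h \<le> multiplicity p l) ls)"
        by (intro filter_length_mono) blast
      moreover have "M dvd q" by (subst M) simp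
      ultimately have "M \<in> moves k ls" unfolding moves_def using small by (simp add: q_def)
      then have "Q dvd M" unfolding Q_def by (rule Gcd_dvd)
      then have "h \<le> multiplicity p M" unfolding h_def using M0 by (intro dvd_imp_multiplicity_le) auto
      then show False using mM h by simp
    qed
    \<comment> \<open>More than \<open>k\<close> numbers of valuation at least \<open>h\<close> give
      their product at least the valuation of \<open>Q ^ Suc k\<close>.\<close>
    have "Suc k * h \<le> (\<Sum>l\<leftarrow>ls. multiplicity p l)"
    proof (cases "h = 0")
      case False
      then have "Suc k * h \<le> h * length (filter (\<lambda>l. h \<le> multiplicity p l) ls)"
        using cnt by (metis gr0I mult.commute mult_le_mono2)
      also have "\<dots> \<le> (\<Sum>l\<leftarrow>ls. multiplicity p l)" by (rule sum_list_ge_threshold_count)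
      finally show ?thesis .
    qed simp
    then show "multiplicity p (Q ^ Suc k) \<le> multiplicity p q"
      using p Q0 multiplicity_prod_list[OF p pos] unfolding q_def h_def
      by (simp only: prime_elem_multiplicity_power_distrib prime_imp_prime_elem)
  qed
  then show ?thesis unfolding Q_def q_def .
qed

section \<open>Jumps of a periodic function across a middle band\<close>

lemma card_periodic_shift_le:
  fixes q :: nat
  assumes per: "\<And>j. P (j mod q) = P j" and q: "q > 0"
  shows "card {j. j < q \<and> P (j + y)} \<le> card {j. j < q \<and> P j}"
proof (rule card_inj_on_le[where f = "\<lambda>j. (j + y) mod q"])
  show "inj_on (\<lambda>j. (j + y) mod q) {j. j < q \<and> P (j + y)}"
  proof (rule inj_onI)
    fix a b assume "a \<in> {j. j < q \<and> P (j + y)}" "b \<in> {j. j < q \<and> P (j + y)}"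
      "(a + y) mod q = (b + y) mod q"
    then show "a = b"
      by (metis (mono_tags, lifting) cong_add_rcancel_nat cong_def mem_Collect_eq mod_less)
  qed
qed (use per q in auto)

lemma sum_list_diff_le_filter:
  fixes f g :: "'b \<Rightarrow> real"
  assumes "\<And>y. y \<in> set ys \<Longrightarrow> f y \<le> 1 \<and> 0 \<le> g y" "\<And>y. y \<in> set ys \<Longrightarrow> \<not> P y \<Longrightarrow> f y = g y"
  shows "(\<Sum>y\<leftarrow>ys. f y) - (\<Sum>y\<leftarrow>ys. g y) \<le> real (length (filter P ys))"
  using assms
proof (induction ys)
  case (Cons a ys)
  have "f a - g a \<le> (if P a then 1 else 0)" using Cons.prems(1)[of a] Cons.prems(2)[of a] by auto
  moreover have "(\<Sum>y\<leftarrow>ys. f y) - (\<Sum>y\<leftarrow>ys. g y) \<le> real (length (filter P ys))"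
    by (rule Cons.IH) (use Cons.prems in auto)
  ultimately show ?case by (auto split: if_splits)
qed auto

text \<open>Modulo \<open>q\<close>, reach \<open>j + y\<close> from \<open>j\<close> by adding one
  multiple of each number in \<open>ms\<close>. No leg lowers \<open>H\<close> by more than the
  width of the band from \<open>lo\<close> to \<open>hi\<close>, so a path from above the band to
  below it stops inside the band after some leg. For each leg, the shift is injective modulo
  \<open>q\<close>, so no more \<open>j\<close> stop there than the band has points.\<close>

lemma card_jumps_le:
  fixes q :: nat and H :: "nat \<Rightarrow> real" and lo hi :: real
  assumes q: "q > 0" and per: "\<And>j. H (j mod q) = H j" and lohi: "lo \<le> hi"
    and step: "\<And>M x j. M \<in> set ms \<Longrightarrow> H j - H (j + x * M) \<le> hi - lo"
    and y: "Gcd (insert q (set ms)) dvd y"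
  shows "card {j. j < q \<and> H j > hi \<and> H (j + y) < lo} \<le> length ms * card {j. j < q \<and> lo \<le> H j \<and> H j \<le> hi}"
  using step y
proof (induction ms arbitrary: y)
  case Nil
  then have "H (j + y) = H j" for j
    by (metis Gcd_insert Gcd_empty gcd_0_nat  list.set(1) mod_add_right_eq dvd_imp_mod_0 add.right_neutral normalize_nat_def id_apply per)
  then have "{j. j < q \<and> H j > hi \<and> H (j + y) < lo} = {}" using lohi by auto
  then show ?case by (metis card.empty zero_le)
next
  case (Cons M ms)
  define g where "g = Gcd (insert q (set ms))"
  have gq: "g dvd q" unfolding g_def by simp
  have "gcd M g dvd y" using Cons.prems(2) unfolding g_def by (simp add: gcd.left_commute)
  then obtain x where x: "[M * x = y] (mod g)" using cong_solve_dvd_nat by blast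
  \<comment> \<open>Modulo \<open>q\<close> this is \<open>y - x * M\<close>; the factor
    \<open>q - 1\<close> stands in for -1, so that the shift stays a natural number. The new shift
    is divisible by \<open>g\<close>, as the induction requires.\<close>
  define y' where "y' = y + (q - 1) * (x * M)"
  have y': "y' + x * M = y + q * (x * M)"
    using q unfolding y'_def by (cases q) (auto simp: algebra_simps)
  have "[y' + x * M = 0 + x * M] (mod g)"
  proof -
    have "[y + q * (x * M) = x * M + 0] (mod g)"
      using x gq by (intro cong_add) (auto simp: cong_sym mult.commute cong_0_iff)
    then show ?thesis by (simp add: y')
  qed
  then have gy': "g dvd y'" by (simp only: cong_add_rcancel_nat cong_0_iff)
  have Hy: "H (j + y) = H ((j + y') + x * M)" for j
    by (metis (no_types, lifting) add.assoc mod_mult_self2 per y')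
  let ?C = "\<lambda>j. lo \<le> H j \<and> H j \<le> hi"
  have "{j. j < q \<and> H j > hi \<and> H (j + y) < lo} \<subseteq>
      {j. j < q \<and> H j > hi \<and> H (j + y') < lo} \<union> {j. j < q \<and> ?C (j + y')}"
  proof
    fix j assume j: "j \<in> {j. j < q \<and> H j > hi \<and> H (j + y) < lo}"
    have "H (j + y') - H (j + y) \<le> hi - lo"
      unfolding Hy using Cons.prems(1)[of M] by simp
    then show "j \<in> {j. j < q \<and> H j > hi \<and> H (j + y') < lo} \<union> {j. j < q \<and> ?C (j + y')}"
      using j by auto
  qed
  then have "card {j. j < q \<and> H j > hi \<and> H (j + y) < lo} \<le>
      card ({j. j < q \<and> H j > hi \<and> H (j + y') < lo} \<union> {j. j < q \<and> ?C (j + y')})"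
    by (intro card_mono) auto
  also have "\<dots> \<le> card {j. j < q \<and> H j > hi \<and> H (j + y') < lo} + card {j. j < q \<and> ?C (j + y')}"
    by (rule card_Un_le)
  also have "\<dots> \<le> length ms * card {j. j < q \<and> ?C j} + card {j. j < q \<and> ?C j}"
  proof (rule add_mono)
    show "card {j. j < q \<and> H j > hi \<and> H (j + y') < lo} \<le> length ms * card {j. j < q \<and> ?C j}"
      using Cons.IH[of y'] Cons.prems(1) gy' unfolding g_def by simp
    show "card {j. j < q \<and> ?C (j + y')} \<le> card {j. j < q \<and> ?C j}"
      by (rule card_periodic_shift_le) (use per q in auto)
  qed
  finally show ?case by simp
qed


text \<open>Count the pairs of a high \<open>j\<close> and a shift \<open>e * Q\<close> that lands
  low. By \<open>rare\<close>, at least half of the \<open>q div Q\<close> shifts land low from any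
  \<open>j\<close>; for a fixed shift, \<open>card_jumps_le\<close> allows at most
  \<open>length ms * mid\<close> high \<open>j\<close>.\<close>

lemma card_high_le_card_middle:
  fixes v :: "'b \<Rightarrow> nat \<Rightarrow> real" and period :: "'b \<Rightarrow> nat"
  assumes len: "length ys = 5 * k"
    and period: "\<And>y. y \<in> set ys \<Longrightarrow> 0 < period y \<and> period y \<le> R"
    and v: "\<And>y j. y \<in> set ys \<Longrightarrow> 0 \<le> v y j \<and> v y j \<le> 1"
    and per: "\<And>y j. y \<in> set ys \<Longrightarrow> v y (j mod period y) = v y j"
  defines "q \<equiv> prod_list (map period ys)" and "H \<equiv> \<lambda>j. \<Sum>y\<leftarrow>ys. v y j"
  defines "hi \<equiv> card {j. j < q \<and> H j > 3 * real k}"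
    and "mid \<equiv> card {j. j < q \<and> 2 * real k \<le> H j \<and> H j \<le> 3 * real k}"
  assumes R: "R > 0" and rare: "2 * R ^ 5 * (hi + mid) \<le> q"
  shows "\<exists>m. 2 ^ m \<le> q \<and> hi \<le> 2 * m * mid"
proof -
  define ls where "ls = map period ys"
  have lspos: "l > 0" "l \<le> R" if "l \<in> set ls" for l using that period by (auto simp: ls_def)
  have q0: "q > 0" unfolding q_def using period by (fastforce simp: prod_list_zero_iff intro!: Nat.gr0I)
  have dvdq: "period y dvd q" if "y \<in> set ys" for y
    unfolding q_def using that by (intro prod_list_dvd) auto
  have qR: "q \<le> R ^ (5 * k)"
  proof -
    have "prod_list (map period zs) \<le> R ^ length zs" if "\<And>y. y \<in> set zs \<Longrightarrow> period y \<le> R" for zs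
      using that by (induction zs) (auto intro!: mult_le_mono)
    then show ?thesis using period len unfolding q_def by metis
  qed
  \<comment> \<open>\<open>Q ^ Suc k\<close> divides \<open>q\<close>, and \<open>q\<close> is at
    most \<open>(R ^ 5) ^ k\<close>; hence \<open>Q\<close> is at most \<open>R ^ 5\<close>,
    independently of \<open>k\<close>.\<close>
  define Q where "Q = Gcd (moves k ls)"
  have qmv: "q \<in> moves k ls"
    unfolding moves_def using dvdq by (auto simp: q_def ls_def filter_empty_conv)
  have Qq: "Q dvd q" unfolding Q_def using qmv by (rule Gcd_dvd)
  then have Q0: "Q > 0" using q0 by (auto intro: Nat.gr0I)
  have "Q ^ Suc k dvd q"
    using Gcd_moves_power_dvd[of ls k] lspos unfolding Q_def q_def ls_def by simp
  then have "Q ^ Suc k \<le> q" using q0 by (rule dvd_imp_le)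
  then have "Q ^ Suc k \<le> (R ^ 5) ^ k" using qR by (simp add: power_mult)
  moreover have "R ^ 5 < Q \<Longrightarrow> (R ^ 5) ^ k < Q ^ Suc k"
  proof -
    assume *: "R ^ 5 < Q"
    have "(R ^ 5) ^ k \<le> Q ^ k" using * by (intro power_mono) auto
    also have "\<dots> < Q ^ Suc k" using * R by (intro power_strict_increasing) (auto intro: le_less_trans[OF _ *])
    finally show ?thesis .
  qed
  ultimately have QR: "Q \<le> R ^ 5" by (meson leD not_le)
  obtain ms where ms: "set ms \<subseteq> moves k ls" "Gcd (insert q (set ms)) = Gcd (insert q (moves k ls))"
    "2 ^ length ms \<le> q"
    using short_list_same_Gcd[OF q0] by blast
  have GQ: "Gcd (insert q (set ms)) = Q"
    using ms(2) qmv unfolding Q_def by (simp add: insert_absorb)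
  have Hper: "H (j mod q) = H j" for j
  proof -
    have "v y (j mod q) = v y j" if "y \<in> set ys" for y
      using per[OF that, of "j mod q"] per[OF that, of j] dvdq[OF that] by (simp add: mod_mod_cancel)
    then show ?thesis unfolding H_def by (simp cong: map_cong)
  qed
  \<comment> \<open>A multiple of a move changes the residue modulo at most \<open>k\<close> of the
    periods, so at most \<open>k\<close> of the \<open>5 * k\<close> summands; this is why a band of
    width \<open>k\<close> suffices.\<close>
  have step: "H j - H (j + x * M) \<le> 3 * real k - 2 * real k" if "M \<in> set ms" for M x j
  proof -
    have eq: "v y j = v y (j + x * M)" if y: "y \<in> set ys" "\<not> \<not> period y dvd M" for y
    proof -
      have "(j + x * M) mod period y = j mod period y" using y(2)
        by (metis add.right_neutral dvd_imp_mod_0 dvd_mult mod_add_right_eq)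
      then show ?thesis using per[OF y(1), of j] per[OF y(1), of "j + x * M"] by simp
    qed
    have "H j - H (j + x * M) \<le> real (length (filter (\<lambda>y. \<not> period y dvd M) ys))"
      unfolding H_def by (rule sum_list_diff_le_filter) (use v eq in auto)
    also have "length (filter (\<lambda>y. \<not> period y dvd M) ys) \<le> k"
      using that ms(1) unfolding moves_def ls_def by (auto simp: filter_map o_def)
    finally show ?thesis by simp
  qed
  have jump: "card {j. j < q \<and> H j > 3 * real k \<and> H (j + e * Q) < 2 * real k} \<le> length ms * mid" for e
    unfolding mid_def by (rule card_jumps_le[OF q0 Hper _ step]) (use GQ in auto)
  define A where "A = {j. j < q \<and> H j > 3 * real k}"
  have finA: "finite A" unfolding A_def by simp
  \<comment> \<open>The shifts \<open>e * Q\<close> with \<open>e < q div Q\<close> are distinct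
    modulo \<open>q\<close>, so those that do not land low hit distinct points counted by
    \<open>hi\<close> or \<open>mid\<close>.\<close>
  have reach: "q div Q \<le> card {e. e < q div Q \<and> H (j + e * Q) < 2 * real k} + (hi + mid)" for j
  proof -
    let ?E = "{e. e < q div Q \<and> \<not> H (j + e * Q) < 2 * real k}"
    have "card ?E \<le> card ({j. j < q \<and> H j > 3 * real k} \<union> {j. j < q \<and> 2 * real k \<le> H j \<and> H j \<le> 3 * real k})"
    proof (rule card_inj_on_le[where f = "\<lambda>e. (j + e * Q) mod q"])
      show "inj_on (\<lambda>e. (j + e * Q) mod q) ?E"
      proof (rule inj_onI)
        fix a b assume ab: "a \<in> ?E" "b \<in> ?E" "(j + a * Q) mod q = (j + b * Q) mod q"
        then have "[a * Q = b * Q] (mod q)" by (metis cong_add_lcancel_nat cong_def)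
        moreover have "a * Q < q" "b * Q < q" using ab Qq Q0
          by (auto simp: less_mult_imp_div_less div_less_iff_less_mult elim!: dvdE)
        ultimately show "a = b" using Q0 by (simp add: cong_def)
      qed
    qed (use q0 Hper in auto)
    also have "\<dots> \<le> hi + mid" unfolding hi_def mid_def by (rule card_Un_le)
    finally have "card ?E \<le> hi + mid" .
    moreover have "card {..<q div Q} = card ({e. e < q div Q \<and> H (j + e * Q) < 2 * real k} \<union> ?E)"
      by (rule arg_cong[where f = card]) auto
    moreover have "\<dots> \<le> card {e. e < q div Q \<and> H (j + e * Q) < 2 * real k} + card ?E" by (rule card_Un_le)
    ultimately show ?thesis by simp
  qed
  have "2 * Q * (hi + mid) \<le> 2 * R ^ 5 * (hi + mid)" using QR by (intro mult_le_mono) auto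
  then have "2 * Q * (hi + mid) \<le> q" using rare by linarith
  then have half: "2 * (hi + mid) \<le> q div Q"
    using Q0 by (simp add: less_eq_div_iff_mult_less_eq mult_ac)
  have "hi * (q div Q) \<le> (\<Sum>j\<in>A. 2 * card {e. e < q div Q \<and> H (j + e * Q) < 2 * real k})"
  proof -
    have le_twice: "a \<le> 2 * b" if "a \<le> b + c" "2 * c \<le> a" for a b c :: nat using that by linarith
    have "q div Q \<le> 2 * card {e. e < q div Q \<and> H (j + e * Q) < 2 * real k}" for j
      by (rule le_twice[OF reach half])
    then have "(\<Sum>j\<in>A. q div Q) \<le> (\<Sum>j\<in>A. 2 * card {e. e < q div Q \<and> H (j + e * Q) < 2 * real k})"
      by (rule sum_mono)
    then show ?thesis by (simp add: A_def hi_def)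
  qed
  also have "\<dots> = 2 * (\<Sum>e<q div Q. card {j. j < q \<and> H j > 3 * real k \<and> H (j + e * Q) < 2 * real k})"
  proof -
    have "(\<Sum>j\<in>A. card {e. e < q div Q \<and> H (j + e * Q) < 2 * real k}) =
        (\<Sum>j\<in>A. \<Sum>e<q div Q. if H (j + e * Q) < 2 * real k then 1 else 0)"
      by (intro sum.cong refl) (simp add: sum.If_cases, simp add: lessThan_def Int_def)
    also have "\<dots> = (\<Sum>e<q div Q. \<Sum>j\<in>A. if H (j + e * Q) < 2 * real k then 1 else 0)"
      by (rule sum.swap)
    also have "\<dots> = (\<Sum>e<q div Q. card {j. j < q \<and> H j > 3 * real k \<and> H (j + e * Q) < 2 * real k})"
      by (intro sum.cong refl) (simp add: sum.If_cases finA, simp add: A_def Int_def conj_assoc)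
    finally show ?thesis by (simp only: sum_distrib_left[symmetric])
  qed
  also have "\<dots> \<le> 2 * (\<Sum>e<q div Q. length ms * mid)"
    by (intro mult_le_mono2 sum_mono jump)
  finally have "hi * (q div Q) \<le> (2 * length ms * mid) * (q div Q)" by (simp add: mult_ac)
  moreover have "q div Q > 0" using Qq q0 Q0 by (simp add: div_greater_zero_iff dvd_imp_le)
  ultimately have "hi \<le> 2 * length ms * mid" by simp
  then show ?thesis using ms(3) by blast
qed

section \<open>Sampling from a mixture\<close>

text \<open>The bound is asked on the supports only, since it will be applied to functions such as
  the square of a return count, which are bounded only on what the chain can reach.\<close>

lemma expectation_bind_pmf:
  fixes f :: "'b \<Rightarrow> real"
  assumes B: "\<And>x y. x \<in> set_pmf M \<Longrightarrow> y \<in> set_pmf (N x) \<Longrightarrow> \<bar>f y\<bar> \<le> B"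
  shows "measure_pmf.expectation (bind_pmf M N) f =
    measure_pmf.expectation M (\<lambda>x. measure_pmf.expectation (N x) f)"
proof -
  have B0: "B \<ge> 0"
    using B set_pmf_not_empty by (metis abs_ge_zero ex_in_conv order.trans)
  \<comment> \<open>Clamping and adding \<open>B\<close> gives a nonnegative function, bounded
    everywhere, that agrees with \<open>f + B\<close> on the supports; the identity for nonnegative
    integrals then applies.\<close>
  define g where "g = (\<lambda>y. max (- B) (min B (f y)) + B)"
  have g: "0 \<le> g y" "g y \<le> 2 * B" for y unfolding g_def using B0 by auto
  have int_g: "integrable (measure_pmf p) g" for p
    by (rule measure_pmf.integrable_const_bound[of _ "2 * B"]) (use g in auto)
  have Eg: "measure_pmf.expectation p f = measure_pmf.expectation p g - B"
    if "\<And>y. y \<in> set_pmf p \<Longrightarrow> \<bar>f y\<bar> \<le> B" for p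
  proof -
    have "measure_pmf.expectation p f = measure_pmf.expectation p (\<lambda>y. g y - B)"
    proof (rule integral_cong_AE)
      show "AE y in measure_pmf p. f y = g y - B"
        using that by (fastforce simp: AE_measure_pmf_iff g_def)
    qed auto
    then show ?thesis using int_g by simp
  qed
  have gE: "0 \<le> measure_pmf.expectation p g" "measure_pmf.expectation p g \<le> 2 * B" for p
    using g by (auto intro!: integral_nonneg_AE measure_pmf.integral_le_const int_g)
  have int_gE: "integrable (measure_pmf M) (\<lambda>x. measure_pmf.expectation (N x) g)"
    by (rule measure_pmf.integrable_const_bound[of _ "2 * B"]) (use gE in auto)
  have "ennreal (measure_pmf.expectation (bind_pmf M N) g) =
      ennreal (measure_pmf.expectation M (\<lambda>x. measure_pmf.expectation (N x) g))"
    using g gE int_g int_gE by (simp add: nn_integral_eq_integral[symmetric])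
  then have *: "measure_pmf.expectation (bind_pmf M N) g =
      measure_pmf.expectation M (\<lambda>x. measure_pmf.expectation (N x) g)"
    using gE by (subst (asm) ennreal_inj) (auto intro!: integral_nonneg_AE)
  have "measure_pmf.expectation M (\<lambda>x. measure_pmf.expectation (N x) f) =
      measure_pmf.expectation M (\<lambda>x. measure_pmf.expectation (N x) g - B)"
    by (rule integral_cong_AE) (use B Eg in \<open>auto simp: AE_measure_pmf_iff\<close>)
  also have "\<dots> = measure_pmf.expectation (bind_pmf M N) g - B"
    using int_gE * by simp
  also have "\<dots> = measure_pmf.expectation (bind_pmf M N) f"
    by (rule Eg[symmetric]) (use B in auto)
  finally show ?thesis by simp
qed

lemma expectation_replicate_pmf_prod:
  fixes h :: "'b \<Rightarrow> real"
  assumes h: "\<And>y. 0 \<le> h y \<and> h y \<le> B"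
  shows "measure_pmf.expectation (replicate_pmf r w) (\<lambda>ys. \<Prod>y\<leftarrow>ys. h y) = measure_pmf.expectation w h ^ r"
proof (induction r)
  case (Suc r)
  have prod_bd: "0 \<le> (\<Prod>y\<leftarrow>ys. h y) \<and> (\<Prod>y\<leftarrow>ys. h y) \<le> B ^ length ys" for ys
    by (induction ys) (use h in \<open>auto intro!: mult_mono mult_nonneg_nonneg intro: order.trans\<close>)
  have bd: "\<bar>\<Prod>y\<leftarrow>ys. h y\<bar> \<le> B ^ length ys" for ys
    using prod_bd[of ys] by auto
  have "measure_pmf.expectation (replicate_pmf (Suc r) w) (\<lambda>ys. \<Prod>y\<leftarrow>ys. h y) =
     measure_pmf.expectation w (\<lambda>x. measure_pmf.expectation
        (bind_pmf (replicate_pmf r w) (\<lambda>xs. return_pmf (x # xs))) (\<lambda>ys. \<Prod>y\<leftarrow>ys. h y))"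
    unfolding replicate_pmf.simps
  proof (rule expectation_bind_pmf[where B = "B ^ Suc r"])
    fix x ys assume "ys \<in> set_pmf (bind_pmf (replicate_pmf r w) (\<lambda>xs. return_pmf (x # xs)))"
    then have "length ys = Suc r" by (auto simp: set_replicate_pmf)
    then show "\<bar>\<Prod>y\<leftarrow>ys. h y\<bar> \<le> B ^ Suc r" using bd[of ys] by simp
  qed
  also have "\<dots> = measure_pmf.expectation w (\<lambda>x. h x * measure_pmf.expectation (replicate_pmf r w) (\<lambda>ys. \<Prod>y\<leftarrow>ys. h y))"
    by (simp add: map_pmf_def[symmetric])
  also have "\<dots> = measure_pmf.expectation w h ^ Suc r"
    using Suc by simp
  finally show ?case .
qed simp

text \<open>\<open>1 + 3 * t\<close> is the chord of the convex function \<open>4 powr t\<close>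
  over the unit interval. It bounds an exponential moment by the mean.\<close>

lemma four_powr_le: "4 powr t \<le> 1 + 3 * t" if "0 \<le> t" "t \<le> (1::real)"
proof -
  have "exp ((1 - t) *\<^sub>R 0 + t *\<^sub>R ln 4) \<le> (1 - t) * exp 0 + t * exp (ln 4 :: real)"
    by (rule convex_onD[OF exp_convex]) (use that in auto)
  then show ?thesis by (simp add: powr_def algebra_simps)
qed

text \<open>Chernoff bound with base 4: each factor has mean at most 1 + 3 * 3/20 = 29/20, and
  Markov's inequality at \<open>16 ^ k = 4 powr (2 * real k)\<close> leaves
  \<open>((29 / 20) ^ 5 / 16) ^ k\<close>, whose base is below 1/2.\<close>

lemma sample_sum_upper_tail:
  fixes v :: "'b \<Rightarrow> real"
  assumes v: "\<And>y. 0 \<le> v y \<and> v y \<le> 1" and mean: "measure_pmf.expectation w v \<le> 3 / 20"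
  shows "measure_pmf.prob (replicate_pmf (5 * k) w) {ys. (\<Sum>y\<leftarrow>ys. v y) \<ge> 2 * real k} \<le> (1 / 2) ^ k"
proof -
  define h where "h = (\<lambda>y. 4 powr v y :: real)"
  have h: "0 \<le> h y \<and> h y \<le> 4" for y
    using v[of y] powr_mono[of "v y" 1 4] by (auto simp: h_def)
  have int_v: "integrable (measure_pmf w) v"
    by (rule measure_pmf.integrable_const_bound[of _ 1]) (use v in auto)
  have int_h: "integrable (measure_pmf w) h"
    by (rule measure_pmf.integrable_const_bound[of _ 4]) (use h in auto)
  have "measure_pmf.expectation w h \<le> measure_pmf.expectation w (\<lambda>y. 1 + 3 * v y)"
    by (rule integral_mono[OF int_h]) (use int_v v four_powr_le in \<open>auto simp: h_def\<close>)
  also have "\<dots> \<le> 29 / 20" using mean int_v by simp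
  finally have Eh: "measure_pmf.expectation w h \<le> 29 / 20" .
  have Eh0: "0 \<le> measure_pmf.expectation w h" using h by (auto intro!: integral_nonneg_AE)
  have prodh: "(\<Prod>y\<leftarrow>ys. h y) = 4 powr (\<Sum>y\<leftarrow>ys. v y)" for ys
    by (induction ys) (auto simp: h_def powr_add)
  let ?P = "replicate_pmf (5 * k) w"
  have prod_bd: "0 \<le> (\<Prod>y\<leftarrow>ys. h y) \<and> (\<Prod>y\<leftarrow>ys. h y) \<le> 4 ^ length ys" for ys
    by (induction ys) (use h in \<open>auto intro!: mult_mono mult_nonneg_nonneg intro: order.trans\<close>)
  have int: "integrable (measure_pmf ?P) (\<lambda>ys. \<Prod>y\<leftarrow>ys. h y)"
    by (rule measure_pmf.integrable_const_bound[of _ "4 ^ (5 * k)"])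
       (auto simp: AE_measure_pmf_iff set_replicate_pmf prod_bd intro: order.trans[OF conjunct2[OF prod_bd]])
  have "measure_pmf.prob ?P {ys. (\<Sum>y\<leftarrow>ys. v y) \<ge> 2 * real k} =
      measure_pmf.prob ?P {ys. (\<Prod>y\<leftarrow>ys. h y) \<ge> 16 ^ k}"
  proof -
    have "(16::real) ^ k = 4 powr (2 * real k)"
      by (simp add: powr_powr[symmetric] powr_realpow)
    then have "(16::real) ^ k \<le> 4 powr t \<longleftrightarrow> 2 * real k \<le> t" for t by simp
    then show ?thesis unfolding prodh by simp
  qed
  also have "\<dots> \<le> measure_pmf.expectation ?P (\<lambda>ys. \<Prod>y\<leftarrow>ys. h y) / 16 ^ k"
    using integral_Markov_inequality_measure[OF int, of "{}" "16 ^ k"] prod_bd by auto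
  also have "\<dots> = (measure_pmf.expectation w h ^ 5 / 16) ^ k"
    using h by (subst expectation_replicate_pmf_prod[of _ 4]) (auto simp: power_mult power_divide)
  also have "\<dots> \<le> ((29 / 20) ^ 5 / 16) ^ k"
    using Eh Eh0 by (intro power_mono divide_right_mono) auto
  also have "\<dots> \<le> (1 / 2) ^ k" by (intro power_mono) (auto simp: power_divide)
  finally show ?thesis .
qed

lemma ex_le_expectation_pmf:
  fixes X :: "'b \<Rightarrow> real"
  assumes int: "integrable (measure_pmf p) X" and E: "measure_pmf.expectation p X \<le> c"
  shows "\<exists>x\<in>set_pmf p. X x \<le> c"
proof (rule ccontr)
  assume "\<not> ?thesis"
  then have *: "AE x in measure_pmf p. c < X x" by (auto simp: AE_measure_pmf_iff)
  have "measure_pmf.expectation p (\<lambda>_. c) < measure_pmf.expectation p X"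
    using * by (intro measure_pmf.integral_less_AE_space int) (auto simp: measure_pmf.emeasure_space_1)
  then show False using E by simp
qed

text \<open>First-moment method: a random sample misrepresents a given \<open>j\<close> with
  probability at most \<open>(1 / 2) ^ k\<close>, so some sample misrepresents at most this fraction
  of the window.\<close>

lemma ex_sample_few_bad:
  fixes v :: "'b \<Rightarrow> nat \<Rightarrow> real" and w :: "'b pmf"
  assumes v: "\<And>y j. 0 \<le> v y j \<and> v y j \<le> 1"
  defines "m \<equiv> \<lambda>j. measure_pmf.expectation w (\<lambda>y. v y j)"
  shows "\<exists>ys. set ys \<subseteq> set_pmf w \<and> length ys = 5 * k \<and>
    real (card {j. j < W \<and> (m j \<le> 3 / 20 \<and> (\<Sum>y\<leftarrow>ys. v y j) \<ge> 2 * real k \<or>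
       m j \<ge> 17 / 20 \<and> (\<Sum>y\<leftarrow>ys. v y j) \<le> 3 * real k)}) \<le> real W * (1 / 2) ^ k"
proof -
  let ?P = "replicate_pmf (5 * k) w"
  define bad where "bad = (\<lambda>j. {ys. m j \<le> 3 / 20 \<and> (\<Sum>y\<leftarrow>ys. v y j) \<ge> 2 * real k \<or>
       m j \<ge> 17 / 20 \<and> (\<Sum>y\<leftarrow>ys. v y j) \<le> 3 * real k})"
  have prob_bad: "measure_pmf.prob ?P (bad j) \<le> (1 / 2) ^ k" for j
  proof -
    have int_v: "integrable (measure_pmf w) (\<lambda>y. v y j)"
      by (rule measure_pmf.integrable_const_bound[of _ 1]) (use v in auto)
    consider "m j \<le> 3 / 20" | "m j \<ge> 17 / 20" | "3 / 20 < m j" "m j < 17 / 20" by linarith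
    then show ?thesis
    proof cases
      case 1
      then have "bad j = {ys. (\<Sum>y\<leftarrow>ys. v y j) \<ge> 2 * real k}" by (auto simp: bad_def)
      then show ?thesis using sample_sum_upper_tail[of "\<lambda>y. v y j" w k] v 1 by (simp add: m_def)
    next
      case 2
      \<comment> \<open>The values \<open>1 - v y j\<close> have mean at most 3/20, and among
        \<open>5 * k\<close> samples a sum of at most \<open>3 * k\<close> means a complementary sum
        of at least \<open>2 * k\<close>; so the upper tail bound applies again.\<close>
      have "measure_pmf.prob ?P (bad j) \<le> measure_pmf.prob ?P {ys. (\<Sum>y\<leftarrow>ys. 1 - v y j) \<ge> 2 * real k}"
      proof (rule measure_pmf.finite_measure_mono_AE)
        have "(\<Sum>y\<leftarrow>ys. 1 - v y j) = real (length ys) - (\<Sum>y\<leftarrow>ys. v y j)" for ys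
          by (induction ys) auto
        then show "AE x in measure_pmf ?P. x \<in> bad j \<longrightarrow> x \<in> {ys. (\<Sum>y\<leftarrow>ys. 1 - v y j) \<ge> 2 * real k}"
          using 2 by (auto simp: AE_measure_pmf_iff set_replicate_pmf bad_def)
      qed auto
      also have "\<dots> \<le> (1 / 2) ^ k"
        using v 2 int_v by (intro sample_sum_upper_tail) (auto simp: m_def)
      finally show ?thesis .
    next
      case 3
      then have "bad j = {}" by (auto simp: bad_def)
      then show ?thesis by simp
    qed
  qed
  have int_ind: "integrable (measure_pmf ?P) (\<lambda>ys. indicator (bad j) ys :: real)" for j
    by (rule measure_pmf.integrable_const_bound[of _ 1]) auto
  have "measure_pmf.expectation ?P (\<lambda>ys. \<Sum>j<W. indicator (bad j) ys) \<le> real W * (1 / 2) ^ k"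
  proof -
    have "measure_pmf.expectation ?P (\<lambda>ys. \<Sum>j<W. indicator (bad j) ys :: real) =
        (\<Sum>j<W. measure_pmf.prob ?P (bad j))"
      using int_ind by (subst Bochner_Integration.integral_sum) auto
    also have "\<dots> \<le> (\<Sum>j<W. (1 / 2) ^ k)" by (intro sum_mono prob_bad)
    finally show ?thesis by simp
  qed
  then obtain ys where ys: "ys \<in> set_pmf ?P" "(\<Sum>j<W. indicator (bad j) ys) \<le> real W * (1 / 2) ^ k"
    using ex_le_expectation_pmf[of ?P "\<lambda>ys. \<Sum>j<W. indicator (bad j) ys"] int_ind by auto
  have "(\<Sum>j<W. indicator (bad j) ys :: real) = real (card {j. j < W \<and> ys \<in> bad j})"
    by (simp add: indicator_def sum.If_cases Int_def)
  then show ?thesis using ys by (intro exI[of _ ys]) (auto simp: set_replicate_pmf bad_def)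
qed

section \<open>Markov chains with few states\<close>

primrec steps :: "('s \<Rightarrow> 's pmf) \<Rightarrow> nat \<Rightarrow> 's \<Rightarrow> 's pmf" where
  "steps K 0 x = return_pmf x"
| "steps K (Suc n) x = bind_pmf (K x) (steps K n)"

lemma steps_add: "steps K (m + n) x = bind_pmf (steps K m x) (steps K n)"
  by (induction m arbitrary: x) (auto simp: bind_return_pmf bind_assoc_pmf intro!: bind_pmf_cong)

lemma steps_0: "steps K 0 = return_pmf"
  by (rule ext) simp

lemma steps_Suc_0: "steps K (Suc 0) = K"
  by (rule ext) (simp add: bind_return_pmf' steps_0)

lemma steps_steps: "steps (steps K l) n x = steps K (n * l) x"
  by (induction n arbitrary: x) (auto simp: steps_add cong: bind_pmf_cong)

lemma bind_steps_add: "bind_pmf (bind_pmf \<mu> (steps K a)) (steps K b) = bind_pmf \<mu> (steps K (a + b))"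
  by (simp add: bind_assoc_pmf steps_add[abs_def])

section \<open>Expectations along the chain and the martingale of returns\<close>

lemma expectation_pmf_bounds:
  fixes g :: "'s \<Rightarrow> real"
  assumes "\<And>x. 0 \<le> g x \<and> g x \<le> 1"
  shows "0 \<le> measure_pmf.expectation p g \<and> measure_pmf.expectation p g \<le> 1"
proof -
  have "integrable (measure_pmf p) g"
    by (rule measure_pmf.integrable_const_bound[of _ 1]) (use assms in auto)
  then show ?thesis using assms by (auto intro!: integral_nonneg_AE measure_pmf.integral_le_const)
qed

lemma expectation_bind_pmf_unit:
  fixes g :: "'s \<Rightarrow> real"
  assumes "\<And>x. 0 \<le> g x \<and> g x \<le> 1"
  shows "measure_pmf.expectation (bind_pmf M N) g =
    measure_pmf.expectation M (\<lambda>x. measure_pmf.expectation (N x) g)"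
  by (rule expectation_bind_pmf[of _ _ _ 1]) (use assms in auto)

text \<open>
  Joint law of the state and of the martingale that counts, among the visits to \<open>y\<close>, the
  immediate returns minus their expected number.
\<close>

primrec returns :: "('s \<Rightarrow> 's pmf) \<Rightarrow> 's \<Rightarrow> 's pmf \<Rightarrow> nat \<Rightarrow> ('s \<times> real) pmf" where
  "returns K y \<mu> 0 = map_pmf (\<lambda>x. (x, 0)) \<mu>"
| "returns K y \<mu> (Suc m) = bind_pmf (returns K y \<mu> m) (\<lambda>p. map_pmf
     (\<lambda>x'. (x', snd p + (if fst p = y then of_bool (x' = y) - pmf (K y) y else 0))) (K (fst p)))"

lemma map_fst_returns: "map_pmf fst (returns K y \<mu> m) = bind_pmf \<mu> (steps K m)"
proof (induction m)
  case 0
  then show ?case by (simp add: pmf.map_comp o_def bind_return_pmf')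
next
  case (Suc m)
  have "map_pmf fst (returns K y \<mu> (Suc m)) = bind_pmf (map_pmf fst (returns K y \<mu> m)) K"
    by (simp add: map_bind_pmf pmf.map_comp o_def bind_map_pmf)
  also have "\<dots> = bind_pmf \<mu> (steps K (m + 1))"
    unfolding Suc steps_add[abs_def] by (simp add: bind_assoc_pmf steps_Suc_0 del: steps.simps)
  finally show ?case by (simp only: Suc_eq_plus1)
qed

lemma abs_returns_le:
  assumes "p \<in> set_pmf (returns K y \<mu> m)" shows "\<bar>snd p\<bar> \<le> real m"
  using assms
proof (induction m arbitrary: p)
  case (Suc m)
  then obtain p' x' where p': "p' \<in> set_pmf (returns K y \<mu> m)"
    and p: "p = (x', snd p' + (if fst p' = y then of_bool (x' = y) - pmf (K y) y else 0))"
    by auto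
  have "\<bar>if fst p' = y then of_bool (x' = y) - pmf (K y) y else 0\<bar> \<le> (1::real)"
    using pmf_le_1[of "K y" y] pmf_nonneg[of "K y" y] by auto
  then show ?case using Suc.IH[OF p'] p by auto
qed auto

lemma integrable_bounded_pmf:
  fixes f :: "'s \<Rightarrow> real"
  assumes "\<And>x. x \<in> set_pmf p \<Longrightarrow> \<bar>f x\<bar> \<le> B"
  shows "integrable (measure_pmf p) f"
  by (rule measure_pmf.integrable_const_bound[of _ B]) (use assms in \<open>auto simp: AE_measure_pmf_iff\<close>)

lemma expectation_of_bool_eq: "measure_pmf.expectation p (\<lambda>x. of_bool (f x = y)) = pmf (map_pmf f p) y"
proof -
  have "(\<lambda>x. of_bool (f x = y)) = (indicator (f -` {y}) :: _ \<Rightarrow> real)" by (auto simp: indicator_def)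
  then show ?thesis by (simp add: pmf_map)
qed

lemma expectation_square_shift:
  fixes D :: "'s \<Rightarrow> real"
  assumes "integrable (measure_pmf p) D" "integrable (measure_pmf p) (\<lambda>x. (D x)\<^sup>2)"
  shows "measure_pmf.expectation p (\<lambda>x. (z + D x)\<^sup>2) =
    z\<^sup>2 + 2 * z * measure_pmf.expectation p D + measure_pmf.expectation p (\<lambda>x. (D x)\<^sup>2)"
proof -
  have "measure_pmf.expectation p (\<lambda>x. (z + D x)\<^sup>2) = measure_pmf.expectation p (\<lambda>x. z\<^sup>2 + 2 * z * D x + (D x)\<^sup>2)"
    by (simp add: power2_sum algebra_simps)
  then show ?thesis using assms by simp
qed

lemma returns_square_le:
  assumes "p \<in> set_pmf (returns K y \<mu> m)" shows "\<bar>(snd p)\<^sup>2\<bar> \<le> (real m)\<^sup>2"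
  using abs_returns_le[OF assms] by (simp add: abs_le_square_iff[symmetric])

text \<open>Martingale increments are orthogonal: given the past, an increment has mean zero and
  square at most 1, so each step adds at most 1 to the second moment.\<close>

lemma expectation_returns_square: "measure_pmf.expectation (returns K y \<mu> m) (\<lambda>p. (snd p)\<^sup>2) \<le> real m"
proof (induction m)
  case (Suc m)
  let ?q = "pmf (K y) y"
  let ?d = "\<lambda>x x'. if x = y then of_bool (x' = y) - ?q else (0::real)"
  let ?J = "returns K y \<mu> m"
  have d: "\<bar>?d x x'\<bar> \<le> 1" for x x' using pmf_le_1[of "K y" y] pmf_nonneg[of "K y" y] by auto
  have int_d: "integrable (measure_pmf (K x)) (?d x)" for x
    by (rule integrable_bounded_pmf[of _ _ 1]) (use d in auto)
  have int_d2: "integrable (measure_pmf (K x)) (\<lambda>x'. (?d x x')\<^sup>2)" for x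
    by (rule integrable_bounded_pmf[of _ _ 1]) (use d in \<open>simp add: abs_square_le_1\<close>)
  have Ed: "measure_pmf.expectation (K x) (?d x) = 0" for x
  proof (cases "x = y")
    case True
    have "integrable (measure_pmf (K y)) (\<lambda>x'. of_bool (x' = y) :: real)"
      by (rule integrable_bounded_pmf[of _ _ 1]) auto
    then show ?thesis using expectation_of_bool_eq[of "K y" "\<lambda>x. x" y] True by (simp add: map_pmf_ident)
  qed simp
  have Ed2: "measure_pmf.expectation (K x) (\<lambda>x'. (?d x x')\<^sup>2) \<le> 1" for x
    by (rule measure_pmf.integral_le_const[OF int_d2]) (use d in \<open>simp add: abs_square_le_1\<close>)
  have inner: "measure_pmf.expectation (K x) (\<lambda>x'. (z + ?d x x')\<^sup>2) \<le> z\<^sup>2 + 1" for x z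
  proof -
    have "measure_pmf.expectation (K x) (\<lambda>x'. (z + ?d x x')\<^sup>2) =
       z\<^sup>2 + 2 * z * measure_pmf.expectation (K x) (?d x) + measure_pmf.expectation (K x) (\<lambda>x'. (?d x x')\<^sup>2)"
      by (rule expectation_square_shift[OF int_d int_d2])
    then show ?thesis using Ed[of x] Ed2[of x] by (simp only:)
  qed
  have "measure_pmf.expectation (returns K y \<mu> (Suc m)) (\<lambda>p. (snd p)\<^sup>2) =
      measure_pmf.expectation ?J (\<lambda>p. measure_pmf.expectation (map_pmf
     (\<lambda>x'. (x', snd p + ?d (fst p) x')) (K (fst p))) (\<lambda>p. (snd p)\<^sup>2))"
    unfolding returns.simps
  proof (rule expectation_bind_pmf[where B = "(real (Suc m))\<^sup>2"])
    fix p p' assume "p \<in> set_pmf ?J" "p' \<in> set_pmf (map_pmf (\<lambda>x'. (x', snd p + ?d (fst p) x')) (K (fst p)))"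
    then have "p' \<in> set_pmf (returns K y \<mu> (Suc m))" by auto
    then show "\<bar>(snd p')\<^sup>2\<bar> \<le> (real (Suc m))\<^sup>2" by (rule returns_square_le)
  qed
  also have "\<dots> = measure_pmf.expectation ?J (\<lambda>p. measure_pmf.expectation (K (fst p)) (\<lambda>x'. (snd p + ?d (fst p) x')\<^sup>2))"
    by simp
  also have "\<dots> \<le> measure_pmf.expectation ?J (\<lambda>p. (snd p)\<^sup>2 + 1)"
  proof (rule integral_mono)
    have sq: "\<bar>(snd p)\<^sup>2\<bar> \<le> (real m)\<^sup>2" if "p \<in> set_pmf ?J" for p
      using that by (rule returns_square_le)
    then show "integrable (measure_pmf ?J) (\<lambda>p. (snd p)\<^sup>2 + 1)"
      by (intro integrable_bounded_pmf[of _ _ "(real m)\<^sup>2 + 1"]) force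
    have "\<bar>measure_pmf.expectation (K (fst p)) (\<lambda>x'. (snd p + ?d (fst p) x')\<^sup>2)\<bar> \<le> (real m)\<^sup>2 + 1" if "p \<in> set_pmf ?J" for p
      using inner[where x = "fst p" and z = "snd p"] sq[OF that] by (subst abs_of_nonneg) auto
    then show "integrable (measure_pmf ?J) (\<lambda>p. measure_pmf.expectation (K (fst p)) (\<lambda>x'. (snd p + ?d (fst p) x')\<^sup>2))"
      by (rule integrable_bounded_pmf)
  qed (rule inner)
  also have "\<dots> = measure_pmf.expectation ?J (\<lambda>p. (snd p)\<^sup>2) + 1"
  proof -
    have "integrable (measure_pmf ?J) (\<lambda>p. (snd p)\<^sup>2)"
      by (rule integrable_bounded_pmf) (rule returns_square_le)
    then show ?thesis by simp
  qed
  finally show ?case using Suc by simp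
qed simp

text \<open>Condition on the last step: its increment contributes only if the chain is then at
  \<open>y\<close>, and the earlier part sees \<open>g\<close> replaced by its one-step average
  \<open>Kg\<close>. Unrolled, a visit at time \<open>i\<close> contributes the return probability
  times the difference between being back at \<open>y\<close> one step later and continuing from
  \<open>y\<close> unconditionally.\<close>

lemma expectation_returns_eq:
  fixes g :: "'s \<Rightarrow> real"
  assumes g: "\<And>x. 0 \<le> g x \<and> g x \<le> 1"
  shows "measure_pmf.expectation (returns K y \<mu> m) (\<lambda>p. snd p * g (fst p)) =
    pmf (K y) y * (\<Sum>i<m. pmf (bind_pmf \<mu> (steps K i)) y *
      (measure_pmf.expectation (steps K (m - 1 - i) y) g - measure_pmf.expectation (steps K (m - i) y) g))"
  using g
proof (induction m arbitrary: g)
  case (Suc m)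
  let ?q = "pmf (K y) y"
  let ?d = "\<lambda>x x'. if x = y then of_bool (x' = y) - ?q else (0::real)"
  let ?J = "returns K y \<mu> m"
  define Kg where "Kg = (\<lambda>x. measure_pmf.expectation (K x) g)"
  have Kg: "0 \<le> Kg x \<and> Kg x \<le> 1" for x unfolding Kg_def by (rule expectation_pmf_bounds) (rule Suc.prems)
  have int_g: "integrable (measure_pmf p) g" for p
    by (rule integrable_bounded_pmf[of _ _ 1]) (use Suc.prems in auto)
  have inner: "measure_pmf.expectation (K x) (\<lambda>x'. (z + ?d x x') * g x') =
      z * Kg x + of_bool (x = y) * (?q * (g y - Kg y))" for x z
  proof (cases "x = y")
    case True
    have [simp]: "integrable (measure_pmf (K y)) (\<lambda>x'. of_bool (x' = y) :: real)"
      by (rule integrable_bounded_pmf[of _ _ 1]) auto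
    have "measure_pmf.expectation (K y) (\<lambda>x'. of_bool (x' = y) * g y) = ?q * g y"
      using expectation_of_bool_eq[of "K y" "\<lambda>x. x" y] by (simp add: map_pmf_ident)
    moreover have "measure_pmf.expectation (K y) (\<lambda>x'. (z + ?d y x') * g x') =
      measure_pmf.expectation (K y) (\<lambda>x'. (z - ?q) * g x' + of_bool (x' = y) * g y)"
      by (rule arg_cong[where f = "measure_pmf.expectation (K y)"]) (auto simp: algebra_simps)
    moreover have "\<dots> = (z - ?q) * Kg y + measure_pmf.expectation (K y) (\<lambda>x'. of_bool (x' = y) * g y)"
      unfolding Kg_def by (subst Bochner_Integration.integral_add) (use int_g[of "K y"] in auto)
    ultimately have "measure_pmf.expectation (K y) (\<lambda>x'. (z + ?d y x') * g x') = (z - ?q) * Kg y + ?q * g y"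
      by linarith
    then show ?thesis using True by (simp add: algebra_simps)
  qed (simp add: Kg_def)
  have "measure_pmf.expectation (returns K y \<mu> (Suc m)) (\<lambda>p. snd p * g (fst p)) =
      measure_pmf.expectation ?J (\<lambda>p. measure_pmf.expectation (map_pmf
     (\<lambda>x'. (x', snd p + ?d (fst p) x')) (K (fst p))) (\<lambda>p. snd p * g (fst p)))"
    unfolding returns.simps
  proof (rule expectation_bind_pmf[where B = "real (Suc m)"])
    fix p p' assume "p \<in> set_pmf ?J" "p' \<in> set_pmf (map_pmf (\<lambda>x'. (x', snd p + ?d (fst p) x')) (K (fst p)))"
    then have "p' \<in> set_pmf (returns K y \<mu> (Suc m))" by auto
    then have "\<bar>snd p'\<bar> \<le> real (Suc m)" by (rule abs_returns_le)
    then show "\<bar>snd p' * g (fst p')\<bar> \<le> real (Suc m)"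
      using Suc.prems[of "fst p'"] mult_mono[of "\<bar>snd p'\<bar>" "real (Suc m)" "g (fst p')" 1] by (simp add: abs_mult)
  qed
  also have "\<dots> = measure_pmf.expectation ?J (\<lambda>p. snd p * Kg (fst p) + of_bool (fst p = y) * (?q * (g y - Kg y)))"
    by (simp add: inner)
  also have "\<dots> = measure_pmf.expectation ?J (\<lambda>p. snd p * Kg (fst p)) +
      pmf (bind_pmf \<mu> (steps K m)) y * (?q * (g y - Kg y))"
  proof -
    have "\<bar>snd p * Kg (fst p)\<bar> \<le> real m" if "p \<in> set_pmf ?J" for p
      using Kg[of "fst p"] abs_returns_le[OF that] mult_mono[of "\<bar>snd p\<bar>" "real m" "Kg (fst p)" 1] by (simp add: abs_mult)
    then have "integrable (measure_pmf ?J) (\<lambda>p. snd p * Kg (fst p))" by (rule integrable_bounded_pmf)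
    moreover have "integrable (measure_pmf ?J) (\<lambda>p. of_bool (fst p = y) :: real)"
      by (rule integrable_bounded_pmf[of _ _ 1]) auto
    ultimately show ?thesis using expectation_of_bool_eq[of ?J fst y] by (simp add: map_fst_returns)
  qed
  also have "measure_pmf.expectation ?J (\<lambda>p. snd p * Kg (fst p)) = ?q * (\<Sum>i<m. pmf (bind_pmf \<mu> (steps K i)) y *
      (measure_pmf.expectation (steps K (Suc m - 1 - i) y) g - measure_pmf.expectation (steps K (Suc m - i) y) g))"
  proof -
    have E: "measure_pmf.expectation (steps K n y) Kg = measure_pmf.expectation (steps K (n + 1) y) g" for n
      unfolding Kg_def steps_add
      by (subst expectation_bind_pmf_unit) (use Suc.prems in \<open>auto simp: bind_return_pmf' steps_0\<close>)
    show ?thesis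
      unfolding Suc.IH[of Kg, OF Kg]
    proof (intro arg_cong[where f = "(*) ?q"] sum.cong refl)
      fix i assume "i \<in> {..<m}"
      then have e: "m - 1 - i + 1 = Suc m - 1 - i" "m - i + 1 = Suc m - i" by auto
      show "pmf (bind_pmf \<mu> (steps K i)) y *
          (measure_pmf.expectation (steps K (m - 1 - i) y) Kg - measure_pmf.expectation (steps K (m - i) y) Kg) =
        pmf (bind_pmf \<mu> (steps K i)) y *
          (measure_pmf.expectation (steps K (Suc m - 1 - i) y) g - measure_pmf.expectation (steps K (Suc m - i) y) g)"
        unfolding E e ..
    qed
  qed
  finally show ?case by (simp add: algebra_simps Kg_def bind_return_pmf' steps_0)
qed (simp)

text \<open>In effect Cauchy-Schwarz with second moment at most \<open>m\<close>, obtained pointwise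
  from the inequality of arithmetic and geometric means with weight
  \<open>sqrt (real m)\<close>.\<close>

lemma abs_expectation_returns_le:
  fixes g :: "'s \<Rightarrow> real"
  assumes g: "\<And>x. 0 \<le> g x \<and> g x \<le> 1"
  shows "\<bar>measure_pmf.expectation (returns K y \<mu> m) (\<lambda>p. snd p * g (fst p))\<bar> \<le> sqrt (real m)"
proof (cases "m = 0")
  case False
  let ?J = "returns K y \<mu> m" and ?s = "sqrt (real m)"
  have s0: "?s > 0" using False by simp
  have int_sq: "integrable (measure_pmf ?J) (\<lambda>p. (snd p)\<^sup>2)"
    by (rule integrable_bounded_pmf) (rule returns_square_le)
  have amgm: "\<bar>z * t\<bar> \<le> (z\<^sup>2 / ?s + ?s) / 2" if "0 \<le> t" "t \<le> 1" for z t :: real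
  proof -
    have "\<bar>z * t\<bar> \<le> \<bar>z\<bar>" using that by (simp add: abs_mult mult_left_le)
    moreover have "2 * \<bar>z\<bar> \<le> z\<^sup>2 / ?s + ?s"
    proof -
      have "0 \<le> (\<bar>z\<bar> - ?s)\<^sup>2 / ?s" using s0 by simp
      also have "(\<bar>z\<bar> - ?s)\<^sup>2 / ?s = z\<^sup>2 / ?s + ?s - 2 * \<bar>z\<bar>"
        using s0 by (simp add: power2_eq_square field_simps abs_mult_self_eq)
      finally show ?thesis by simp
    qed
    ultimately show ?thesis by simp
  qed
  have "\<bar>measure_pmf.expectation ?J (\<lambda>p. snd p * g (fst p))\<bar> \<le> measure_pmf.expectation ?J (\<lambda>p. \<bar>snd p * g (fst p)\<bar>)"
    by (rule integral_abs_bound)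
  also have "\<dots> \<le> measure_pmf.expectation ?J (\<lambda>p. ((snd p)\<^sup>2 / ?s + ?s) / 2)"
  proof (rule integral_mono_AE)
    show 1: "integrable (measure_pmf ?J) (\<lambda>p. ((snd p)\<^sup>2 / ?s + ?s) / 2)" using int_sq by simp
    have ag: "\<bar>snd p * g (fst p)\<bar> \<le> ((snd p)\<^sup>2 / ?s + ?s) / 2" for p
      using g[of "fst p"] by (intro amgm) auto
    show "integrable (measure_pmf ?J) (\<lambda>p. \<bar>snd p * g (fst p)\<bar>)"
      by (rule Bochner_Integration.integrable_bound[OF 1]) (use ag in \<open>auto intro: order.trans\<close>)
    show "AE p in measure_pmf ?J. \<bar>snd p * g (fst p)\<bar> \<le> ((snd p)\<^sup>2 / ?s + ?s) / 2"
      using ag by simp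
  qed
  also have "\<dots> = (measure_pmf.expectation ?J (\<lambda>p. (snd p)\<^sup>2) / ?s + ?s) / 2"
    using int_sq by simp
  also have "\<dots> \<le> (real m / ?s + ?s) / 2"
    using expectation_returns_square[of K y \<mu> m] s0 by (intro divide_right_mono add_right_mono) auto
  also have "\<dots> = ?s" by (simp add: real_div_sqrt)
  finally show ?thesis .
qed simp


text \<open>
  Inserting a loop of length \<open>l\<close> at a visit to \<open>y\<close> turns \<open>T\<close> steps into \<open>T + l\<close> steps. The
  two sides differ by the fluctuation of the number of such loops around its conditional mean.
\<close>

lemma shift_by_return_time:
  fixes g :: "'s \<Rightarrow> real"
  assumes g: "\<And>x. 0 \<le> g x \<and> g x \<le> 1"
    and q: "q > 0" "q \<le> pmf (steps K l y) y" and l: "l > 0" and NT: "N \<le> T"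
  shows "\<bar>\<Sum>a<N. pmf (bind_pmf \<mu> (steps K a)) y *
     (measure_pmf.expectation (steps K (T + l - a) y) g - measure_pmf.expectation (steps K (T - a) y) g)\<bar>
     \<le> real l * (sqrt (real N) / q + 1)" (is "\<bar>sum ?h _\<bar> \<le> _")
proof -
  \<comment> \<open>Times below \<open>m * l\<close> are split by residue modulo \<open>l\<close>.
    Within one class the chain is observed every \<open>l\<close> steps, and a loop at
    \<open>y\<close> becomes an immediate return of \<open>steps K l\<close>. Fewer than
    \<open>l\<close> times are left over.\<close>
  define m where "m = N div l"
  define G where "G = (\<lambda>t. measure_pmf.expectation (steps K t y) g)"
  have G: "0 \<le> G t \<and> G t \<le> 1" for t unfolding G_def by (rule expectation_pmf_bounds) (rule g)
  have mlN: "m * l \<le> N" unfolding m_def by simp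
  have hG: "?h a = pmf (bind_pmf \<mu> (steps K a)) y * (G (T + l - a) - G (T - a))" for a
    unfolding G_def ..
  have h1: "\<bar>?h a\<bar> \<le> 1" for a
  proof -
    have "\<bar>G (T + l - a) - G (T - a)\<bar> \<le> 1" using G[of "T + l - a"] G[of "T - a"] by linarith
    then show ?thesis unfolding hG abs_mult
      using pmf_le_1[of "bind_pmf \<mu> (steps K a)" y] pmf_nonneg[of "bind_pmf \<mu> (steps K a)" y]
      by (simp add: mult_le_one)
  qed
  have rest: "\<bar>sum ?h {m * l..<N}\<bar> \<le> real l"
  proof -
    have "\<bar>sum ?h {m * l..<N}\<bar> \<le> (\<Sum>a\<in>{m * l..<N}. 1)"
      by (rule order.trans[OF sum_abs sum_mono]) (rule h1)
    also have "\<dots> = real (N - m * l)" by simp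
    also have "N - m * l = N mod l" unfolding m_def by (simp add: minus_div_mult_eq_mod)
    also have "real (N mod l) \<le> real l" using l by (simp add: less_imp_le)
    finally show ?thesis .
  qed
  have classes: "\<bar>\<Sum>i<m. ?h (i * l + r)\<bar> \<le> sqrt (real N) / q" if r: "r < l" for r
  proof (cases "m = 0")
    case False
    \<comment> \<open>The number of steps from the last time of the class to \<open>T\<close>; the
      test function is \<open>g\<close> averaged over these steps.\<close>
    define e where "e = T - r - (m - 1) * l"
    have "(m - 1) * l + l = m * l" using False by (cases m) auto
    then have e: "T = e + r + (m - 1) * l" using r mlN NT unfolding e_def by linarith
    let ?L = "steps K l" and ?g = "\<lambda>x. measure_pmf.expectation (steps K e x) g"
      and ?\<mu> = "bind_pmf \<mu> (steps K r)"
    have g': "0 \<le> ?g x \<and> ?g x \<le> 1" for x by (rule expectation_pmf_bounds) (rule g)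
    have Gsteps: "measure_pmf.expectation (steps ?L n y) ?g = G (n * l + e)" for n
      unfolding G_def steps_add steps_steps
      by (rule expectation_bind_pmf_unit[symmetric]) (rule g)
    have eq: "(\<Sum>i<m. ?h (i * l + r)) = - (\<Sum>i<m. pmf (bind_pmf ?\<mu> (steps ?L i)) y *
      (measure_pmf.expectation (steps ?L (m - 1 - i) y) ?g - measure_pmf.expectation (steps ?L (m - i) y) ?g))"
      unfolding sum_negf[symmetric]
    proof (rule sum.cong[OF refl])
      fix i assume "i \<in> {..<m}"
      then obtain u where u: "m = i + u + 1" by (metis add.assoc add.commute lessThan_iff less_imp_add_positive Suc_eq_plus1 gr0_implies_Suc)
      have p: "bind_pmf ?\<mu> (steps ?L i) = bind_pmf \<mu> (steps K (i * l + r))"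
        unfolding steps_steps[abs_def] bind_steps_add by (simp add: add.commute)
      have t1: "T + l - (i * l + r) = (m - i) * l + e" unfolding e u by (simp add: algebra_simps)
      have t2: "T - (i * l + r) = (m - 1 - i) * l + e" unfolding e u by (simp add: algebra_simps)
      show "?h (i * l + r) = - (pmf (bind_pmf ?\<mu> (steps ?L i)) y *
      (measure_pmf.expectation (steps ?L (m - 1 - i) y) ?g - measure_pmf.expectation (steps ?L (m - i) y) ?g))"
        unfolding hG t1 t2 p Gsteps by (simp add: G_def algebra_simps)
    qed
    have ret: "measure_pmf.expectation (returns ?L y ?\<mu> m) (\<lambda>p. snd p * ?g (fst p)) =
      pmf (?L y) y * (\<Sum>i<m. pmf (bind_pmf ?\<mu> (steps ?L i)) y *
      (measure_pmf.expectation (steps ?L (m - 1 - i) y) ?g - measure_pmf.expectation (steps ?L (m - i) y) ?g))"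
      by (rule expectation_returns_eq[OF g'])
    have "pmf (?L y) y * \<bar>\<Sum>i<m. ?h (i * l + r)\<bar> =
        \<bar>measure_pmf.expectation (returns ?L y ?\<mu> m) (\<lambda>p. snd p * ?g (fst p))\<bar>"
      unfolding ret eq abs_mult abs_minus_cancel by simp
    also have "\<dots> \<le> sqrt (real m)" by (rule abs_expectation_returns_le) (rule g')
    also have "\<dots> \<le> sqrt (real N)" unfolding m_def by (simp add: div_le_dividend)
    finally have "pmf (?L y) y * \<bar>\<Sum>i<m. ?h (i * l + r)\<bar> \<le> sqrt (real N)" .
    then have "q * \<bar>\<Sum>i<m. ?h (i * l + r)\<bar> \<le> sqrt (real N)"
      using mult_right_mono[OF q(2), of "\<bar>\<Sum>i<m. ?h (i * l + r)\<bar>"] by linarith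
    then show ?thesis using q by (simp add: pos_le_divide_eq mult.commute)
  qed (use q in simp)
  have "sum ?h {..<N} = sum ?h {..<m * l} + sum ?h {m * l..<N}"
    using mlN by (metis (no_types, lifting) atLeast0LessThan sum.atLeastLessThan_concat zero_le)
  also have "sum ?h {..<m * l} = (\<Sum>i<m. \<Sum>r<l. ?h (i * l + r))"
  proof -
    have "sum ?h {i * l..<i * l + l} = (\<Sum>r<l. ?h (i * l + r))" for i
      using sum.shift_bounds_nat_ivl[of ?h 0 "i * l" l] by (simp add: atLeast0LessThan add.commute)
    then show ?thesis by (simp only: sum.nat_group[symmetric])
  qed
  also have "\<dots> = (\<Sum>r<l. \<Sum>i<m. ?h (i * l + r))" by (rule sum.swap)
  finally have "\<bar>sum ?h {..<N}\<bar> \<le> \<bar>\<Sum>r<l. \<Sum>i<m. ?h (i * l + r)\<bar> + \<bar>sum ?h {m * l..<N}\<bar>" by linarith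
  also have "\<bar>\<Sum>r<l. \<Sum>i<m. ?h (i * l + r)\<bar> \<le> (\<Sum>r<l. sqrt (real N) / q)"
    by (rule order.trans[OF sum_abs sum_mono]) (rule classes, simp)
  finally show ?thesis using rest by (simp add: algebra_simps)
qed

text \<open>Nothing is counted before the first visit to \<open>y\<close>, and from then on no more
  steps remain than when starting there.\<close>

lemma visits_le_visits_from_self:
  "(\<Sum>b<R. pmf (steps K b x) y) \<le> (\<Sum>b<R. pmf (steps K b y) y)"
proof (induction R arbitrary: x)
  case (Suc R)
  show ?case
  proof (cases "x = y")
    case False
    have int: "integrable (measure_pmf (K x)) (\<lambda>z. pmf (steps K b z) y)" for b
      by (rule integrable_bounded_pmf[of _ _ 1]) (simp add: pmf_le_1)
    have "(\<Sum>b<Suc R. pmf (steps K b x) y) = (\<Sum>b<R. measure_pmf.expectation (K x) (\<lambda>z. pmf (steps K b z) y))"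
      using False by (simp add: sum.lessThan_Suc_shift pmf_bind del: sum.lessThan_Suc)
    also have "\<dots> = measure_pmf.expectation (K x) (\<lambda>z. \<Sum>b<R. pmf (steps K b z) y)"
      using int by simp
    also have "\<dots> \<le> (\<Sum>b<R. pmf (steps K b y) y)"
      by (rule measure_pmf.integral_le_const) (use int Suc.IH in auto)
    also have "\<dots> \<le> (\<Sum>b<Suc R. pmf (steps K b y) y)" by simp
    finally show ?thesis .
  qed simp
qed simp

text \<open>A block of \<open>R\<close> times started at \<open>y\<close> has at most 2 expected
  visits: 1 for the start, and fewer than \<open>R\<close> returns of probability at most
  \<open>1 / real R\<close>. By \<open>visits_le_visits_from_self\<close>, 2 bounds every block,
  whatever the law at its start.\<close>

lemma rarely_visited_if_rarely_returning:
  assumes ret: "\<And>b. 0 < b \<Longrightarrow> b < R \<Longrightarrow> pmf (steps K b y) y \<le> 1 / real R"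
  shows "(\<Sum>a<N' * R. pmf (bind_pmf \<mu> (steps K a)) y) \<le> 2 * real N'"
proof -
  have "(\<Sum>b<R. pmf (steps K b y) y) \<le> 2"
  proof (cases R)
    case (Suc R')
    have "(\<Sum>b<R. pmf (steps K b y) y) = 1 + (\<Sum>b<R'. pmf (steps K (Suc b) y) y)"
      unfolding Suc by (simp add: sum.lessThan_Suc_shift del: sum.lessThan_Suc steps.simps(2))
    also have "(\<Sum>b<R'. pmf (steps K (Suc b) y) y) \<le> (\<Sum>b<R'. 1 / real R)"
      using Suc by (intro sum_mono ret) auto
    also have "\<dots> \<le> 1" using Suc by simp
    finally show ?thesis by simp
  qed simp
  then have U: "(\<Sum>b<R. pmf (steps K b x) y) \<le> 2" for x
    using visits_le_visits_from_self[of K x y R] by linarith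
  have block: "(\<Sum>b<R. pmf (bind_pmf \<mu> (steps K (a + b))) y) \<le> 2" for a
  proof -
    let ?M = "bind_pmf \<mu> (steps K a)"
    have int: "integrable (measure_pmf ?M) (\<lambda>z. pmf (steps K b z) y)" for b
      by (rule integrable_bounded_pmf[of _ _ 1]) (simp add: pmf_le_1)
    have "(\<Sum>b<R. pmf (bind_pmf \<mu> (steps K (a + b))) y) = (\<Sum>b<R. measure_pmf.expectation ?M (\<lambda>z. pmf (steps K b z) y))"
      unfolding bind_steps_add[symmetric] by (simp only: pmf_bind[of ?M])
    also have "\<dots> = measure_pmf.expectation ?M (\<lambda>z. \<Sum>b<R. pmf (steps K b z) y)"
      using int by simp
    also have "\<dots> \<le> 2"
      by (rule measure_pmf.integral_le_const) (use int U in auto)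
    finally show ?thesis .
  qed
  have "(\<Sum>a<N' * R. pmf (bind_pmf \<mu> (steps K a)) y) = (\<Sum>i<N'. \<Sum>b<R. pmf (bind_pmf \<mu> (steps K (i * R + b))) y)"
    (is "sum ?f _ = _")
  proof -
    have "sum ?f {i * R..<i * R + R} = (\<Sum>b<R. ?f (i * R + b))" for i
      using sum.shift_bounds_nat_ivl[of ?f 0 "i * R" R] by (simp add: atLeast0LessThan add.commute)
    then show ?thesis by (simp only: sum.nat_group[symmetric])
  qed
  also have "\<dots> \<le> (\<Sum>i<N'. 2)" by (rule sum_mono) (rule block)
  finally show ?thesis by simp
qed


text \<open>The mixing law is that of the state at a uniform time below \<open>N\<close>. The
  component of a state \<open>y\<close> repeats the conditional contribution of \<open>y\<close> at
  the start of the window, with a likely return time as period. States without one carry little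
  weight and get the component 0.\<close>

lemma approx_periodic_mixture:
  fixes K :: "'s \<Rightarrow> 's pmf" and g :: "'s \<Rightarrow> real"
  assumes g: "\<And>x. 0 \<le> g x \<and> g x \<le> 1"
    and fin: "finite \<Omega>" and supp: "\<And>a. a < N \<Longrightarrow> set_pmf (bind_pmf \<mu> (steps K a)) \<subseteq> \<Omega>"
    and R: "128 * card \<Omega> \<le> R" "R > 0" and W: "W > 0" and N: "N = (W * R ^ 3)\<^sup>2" and NT: "N \<le> T"
  shows "\<exists>(w :: 's pmf) period v. (\<forall>y. 0 < period y \<and> period y \<le> R) \<and>
    (\<forall>y j. 0 \<le> v y j \<and> v y j \<le> (1::real)) \<and> (\<forall>y j. v y (j mod period y) = v y j) \<and>
    (\<forall>j<W. \<bar>measure_pmf.expectation (bind_pmf \<mu> (steps K (T + j))) g -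
        measure_pmf.expectation w (\<lambda>y. v y j)\<bar> \<le> 1 / 20)"
proof -
  have N0: "N > 0" using N W R by simp
  define w where "w = bind_pmf (pmf_of_set {..<N}) (\<lambda>a. bind_pmf \<mu> (steps K a))"
  define G where "G = (\<lambda>y t. measure_pmf.expectation (steps K t y) g)"
  \<comment> \<open>The contribution of the paths to \<open>p(t)\<close>, weighted by the fraction of the first \<open>N\<close> steps spent at \<open>y\<close>.\<close>
  define \<phi> where "\<phi> = (\<lambda>y t. (\<Sum>a<N. pmf (bind_pmf \<mu> (steps K a)) y * G y (t - a)) / real N)"
  have G: "0 \<le> G y t \<and> G y t \<le> 1" for y t unfolding G_def by (rule expectation_pmf_bounds) (rule g)
  have pw: "pmf w y = (\<Sum>a<N. pmf (bind_pmf \<mu> (steps K a)) y) / real N" for y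
    unfolding w_def pmf_bind[of "pmf_of_set {..<N}"] using N0 by (subst integral_pmf_of_set) auto
  have phi0: "0 \<le> \<phi> y t" for y t
    unfolding \<phi>_def using G by (intro divide_nonneg_nonneg sum_nonneg mult_nonneg_nonneg) auto
  have phi1: "\<phi> y t \<le> pmf w y" for y t
    unfolding \<phi>_def pw using G by (intro divide_right_mono sum_mono mult_left_le) auto
  \<comment> \<open>The Markov property at time \<open>a\<close> splits the expectation over the
    state at that time; this is averaged over all \<open>a < N\<close>.\<close>
  have split: "measure_pmf.expectation (bind_pmf \<mu> (steps K t)) g = (\<Sum>y\<in>\<Omega>. \<phi> y t)" if t: "N \<le> t" for t
  proof -
    have "measure_pmf.expectation (bind_pmf \<mu> (steps K t)) g =
        (\<Sum>y\<in>\<Omega>. pmf (bind_pmf \<mu> (steps K a)) y * G y (t - a))" if a: "a < N" for a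
    proof -
      have "bind_pmf \<mu> (steps K t) = bind_pmf (bind_pmf \<mu> (steps K a)) (steps K (t - a))"
        using a t by (simp add: bind_steps_add)
      then have "measure_pmf.expectation (bind_pmf \<mu> (steps K t)) g =
          measure_pmf.expectation (bind_pmf \<mu> (steps K a)) (\<lambda>y. G y (t - a))"
        using g by (simp add: expectation_bind_pmf_unit[of g "bind_pmf \<mu> (steps K a)"] G_def)
      also have "\<dots> = (\<Sum>y\<in>\<Omega>. pmf (bind_pmf \<mu> (steps K a)) y * G y (t - a))"
        using supp[OF a] by (subst integral_measure_pmf[OF fin]) auto
      finally show ?thesis .
    qed
    then have "(\<Sum>a<N. measure_pmf.expectation (bind_pmf \<mu> (steps K t)) g) =
        (\<Sum>a<N. \<Sum>y\<in>\<Omega>. pmf (bind_pmf \<mu> (steps K a)) y * G y (t - a))"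
      by (intro sum.cong) auto
    also have "\<dots> = (\<Sum>y\<in>\<Omega>. \<Sum>a<N. pmf (bind_pmf \<mu> (steps K a)) y * G y (t - a))" by (rule sum.swap)
    finally show ?thesis using N0 unfolding \<phi>_def by (simp add: sum_divide_distrib[symmetric] field_simps)
  qed
  define returning where "returning = (\<lambda>y l. 0 < l \<and> l \<le> R \<and> 1 / real R \<le> pmf (steps K l y) y)"
  define good where "good = (\<lambda>y. \<exists>l. returning y l)"
  \<comment> \<open>The period 1 is a filler for states without a likely return, whose component is
    zero.\<close>
  define period where "period = (\<lambda>y. if good y then SOME l. returning y l else 1)"
  have good: "returning y (period y)" if "good y" for y
    using that someI_ex[of "returning y"] unfolding period_def good_def by auto
  have period: "0 < period y" "period y \<le> R" for y
    using good[of y] R by (auto simp: returning_def) (auto simp: period_def)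
  define v where "v = (\<lambda>y j. if good y then \<phi> y (T + j mod period y) / pmf w y else 0)"
  \<comment> \<open>The error of shifting by one period: \<open>shift_by_return_time\<close> gives
    at most \<open>2 * R\<^sup>2 / sqrt N\<close>, and \<open>N = (W * R ^ 3)\<^sup>2\<close> turns
    this into \<open>\<eta>\<close>. Even \<open>W\<close> such shifts then cost only
    \<open>2 / R\<close>.\<close>
  define \<eta> where "\<eta> = 2 / (real W * real R)"
  have sqN: "sqrt (real N) = real W * real R ^ 3" unfolding N by simp
  have phi_shift: "\<bar>\<phi> y (t + period y) - \<phi> y t\<bar> \<le> \<eta>" if y: "good y" and t: "N \<le> t" for y t
  proof -
    have "\<phi> y (t + period y) - \<phi> y t = (\<Sum>a<N. pmf (bind_pmf \<mu> (steps K a)) y *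
       (measure_pmf.expectation (steps K (t + period y - a) y) g - measure_pmf.expectation (steps K (t - a) y) g)) / real N"
      unfolding \<phi>_def G_def diff_divide_distrib[symmetric] sum_subtractf[symmetric] right_diff_distrib ..
    moreover have "\<bar>\<Sum>a<N. pmf (bind_pmf \<mu> (steps K a)) y *
       (measure_pmf.expectation (steps K (t + period y - a) y) g - measure_pmf.expectation (steps K (t - a) y) g)\<bar>
       \<le> real (period y) * (sqrt (real N) / (1 / real R) + 1)"
      by (rule shift_by_return_time[OF g]) (use good[OF y] R t in \<open>auto simp: returning_def\<close>)
    ultimately have "\<bar>\<phi> y (t + period y) - \<phi> y t\<bar> \<le> real (period y) * (sqrt (real N) / (1 / real R) + 1) / real N"
      using N0 by (simp add: divide_right_mono)
    also have "\<dots> \<le> real R * (sqrt (real N) * real R + 1) / real N"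
      using period(2)[of y] by (intro divide_right_mono mult_mono) auto
    also have "\<dots> \<le> real R * (2 * (sqrt (real N) * real R)) / real N"
    proof -
      have "1 \<le> sqrt (real N) * real R"
        using N0 R mult_mono[of 1 "sqrt (real N)" 1 "real R"] by simp
      then show ?thesis by (intro divide_right_mono mult_left_mono) (auto simp: mult.commute)
    qed
    also have "\<dots> = \<eta>"
      unfolding sqN unfolding N \<eta>_def using W R(2) by (simp add: field_simps power2_eq_square power3_eq_cube)
    finally show ?thesis .
  qed
  have phi_shifts: "\<bar>\<phi> y (t + c * period y) - \<phi> y t\<bar> \<le> real c * \<eta>" if y: "good y" and t: "N \<le> t" for y t c
  proof (induction c)
    case (Suc c)
    have "\<bar>\<phi> y ((t + c * period y) + period y) - \<phi> y (t + c * period y)\<bar> \<le> \<eta>"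
      using t by (intro phi_shift[OF y]) simp
    then show ?case using Suc by (simp add: algebra_simps)
  qed simp
  have \<eta>0: "\<eta> \<ge> 0" unfolding \<eta>_def by simp
  have phi_mod: "\<bar>\<phi> y (T + j) - \<phi> y (T + j mod period y)\<bar> \<le> 2 / real R" if y: "good y" and j: "j < W" for y j
  proof -
    have "\<bar>\<phi> y ((T + j mod period y) + (j div period y) * period y) - \<phi> y (T + j mod period y)\<bar> \<le> real (j div period y) * \<eta>"
      using NT by (intro phi_shifts[OF y]) simp
    moreover have "(T + j mod period y) + (j div period y) * period y = T + j" by simp
    moreover have "real (j div period y) * \<eta> \<le> real W * \<eta>"
      using j div_le_dividend[of j "period y"] by (intro mult_right_mono \<eta>0) linarith
    moreover have "real W * \<eta> = 2 / real R" unfolding \<eta>_def using W by simp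
    ultimately show ?thesis by simp
  qed
  have bad: "\<bar>\<phi> y t\<bar> \<le> 2 / real R" if y: "\<not> good y" for y t
  proof -
    define N' where "N' = W\<^sup>2 * R ^ 5"
    have N': "N = N' * R" unfolding N N'_def by (simp add: power2_eq_square eval_nat_numeral)
    have "(\<Sum>a<N' * R. pmf (bind_pmf \<mu> (steps K a)) y) \<le> 2 * real N'"
    proof (rule rarely_visited_if_rarely_returning)
      fix b assume "0 < b" "b < R"
      then show "pmf (steps K b y) y \<le> 1 / real R"
        using y unfolding good_def returning_def by (metis less_imp_le linear)
    qed
    then have "pmf w y \<le> 2 * real N' / real N" unfolding pw N' by (intro divide_right_mono) auto
    also have "\<dots> = 2 / real R" using N0 unfolding N' by simp
    finally show ?thesis using phi0[of y t] phi1[of y t] by linarith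
  qed
  \<comment> \<open>If \<open>pmf w y = 0\<close>, the division in \<open>v\<close> yields 0, and
    \<open>\<phi>\<close> vanishes as well, being at most \<open>pmf w y\<close>.\<close>
  have pv: "pmf w y * v y j = (if good y then \<phi> y (T + j mod period y) else 0)" for y j
  proof (cases "pmf w y = 0")
    case True
    then have "\<phi> y (T + j mod period y) = 0"
      using phi0[of y "T + j mod period y"] phi1[of y "T + j mod period y"] by linarith
    then show ?thesis using True by simp
  qed (simp add: v_def)
  have "set_pmf (pmf_of_set {..<N}) = {..<N}" using N0 by (intro set_pmf_of_set) auto
  then have wsupp: "set_pmf w \<subseteq> \<Omega>"
    unfolding w_def using supp by (subst set_bind_pmf) blast
  have approx: "\<bar>measure_pmf.expectation (bind_pmf \<mu> (steps K (T + j))) g -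
        measure_pmf.expectation w (\<lambda>y. v y j)\<bar> \<le> 1 / 20" if j: "j < W" for j
  proof -
    have "measure_pmf.expectation w (\<lambda>y. v y j) = (\<Sum>y\<in>\<Omega>. pmf w y * v y j)"
      using wsupp by (subst integral_measure_pmf[OF fin]) auto
    then have "\<bar>measure_pmf.expectation (bind_pmf \<mu> (steps K (T + j))) g - measure_pmf.expectation w (\<lambda>y. v y j)\<bar> =
        \<bar>\<Sum>y\<in>\<Omega>. \<phi> y (T + j) - (if good y then \<phi> y (T + j mod period y) else 0)\<bar>"
      using NT by (simp add: split sum_subtractf pv)
    \<comment> \<open>Each state errs by at most \<open>2 / R\<close>, and there are at most
      \<open>R / 128\<close> states, so the total is at most 1/64.\<close>
    also have "\<dots> \<le> (\<Sum>y\<in>\<Omega>. 2 / real R)"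
      by (rule order.trans[OF sum_abs sum_mono]) (use phi_mod[OF _ j] bad in auto)
    also have "\<dots> = 2 * real (card \<Omega>) / real R" by simp
    also have "\<dots> \<le> 1 / 20"
    proof -
      have "real (128 * card \<Omega>) \<le> real R" using R(1) by (simp only: of_nat_le_iff)
      then show ?thesis using R by (simp add: field_simps)
    qed
    finally show ?thesis .
  qed
  have v: "0 \<le> v y j \<and> v y j \<le> 1" for y j
    unfolding v_def using phi0 phi1 by (simp add: divide_le_eq_1 less_le)
  have vper: "v y (j mod period y) = v y j" for y j unfolding v_def by simp
  show ?thesis
    using period v vper approx by (intro exI[of _ w] exI[of _ period] exI[of _ v]) auto
qed

section \<open>The lower bound\<close>

lemma card_periodic_window:
  fixes q :: nat
  assumes per: "\<And>j. P (j mod q) = P j"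
  shows "card {j. j < z * q \<and> P j} = z * card {j. j < q \<and> P j}"
proof -
  have card_sum: "card {j. j < n \<and> P j} = (\<Sum>j<n. of_bool (P j))" for n
    by (simp add: of_bool_def sum.If_cases Int_def)
  have "sum (\<lambda>j. of_bool (P j)) {i * q..<i * q + q} = (\<Sum>j<q. of_bool (P j) :: nat)" for i
  proof -
    have "sum (\<lambda>j. of_bool (P j)) {i * q..<i * q + q} = (\<Sum>j<q. of_bool (P (j + i * q)) :: nat)"
      using sum.shift_bounds_nat_ivl[of "\<lambda>j. of_bool (P j) :: nat" 0 "i * q" q] by (simp add: atLeast0LessThan add.commute)
    moreover have "P (j + i * q) = P j" for j using per[of "j + i * q"] per[of j] by simp
    ultimately show ?thesis by simp
  qed
  then show ?thesis unfolding card_sum by (simp add: sum.nat_group[symmetric])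
qed

text \<open>Discrete intermediate values: moving the window by one place changes the count by at
  most 1.\<close>

lemma ex_window_with_count:
  fixes f :: "nat \<Rightarrow> bool"
  assumes "N \<le> n" and lo: "\<And>j. j < W \<Longrightarrow> \<not> f (N + j)" and hi: "\<And>j. j < W \<Longrightarrow> f (n + j)" and D: "D \<le> W"
  shows "\<exists>T. N \<le> T \<and> T \<le> n \<and> card {j. j < W \<and> f (T + j)} = D"
proof -
  define cnt where "cnt = (\<lambda>T. \<Sum>j<W. of_bool (f (T + j)) :: int)"
  have cnt: "cnt T = int (card {j. j < W \<and> f (T + j)})" for T
    unfolding cnt_def by (simp add: of_bool_def sum.If_cases Int_def)
  have step: "\<bar>cnt (Suc T) - cnt T\<bar> \<le> 1" for T
  proof -
    have "cnt T + of_bool (f (T + W)) = (\<Sum>j<Suc W. of_bool (f (T + j)))" unfolding cnt_def by simp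
    also have "\<dots> = of_bool (f T) + cnt (Suc T)"
      unfolding cnt_def by (simp add: sum.lessThan_Suc_shift del: sum.lessThan_Suc)
    finally show ?thesis by (auto simp: of_bool_def split: if_splits)
  qed
  have "{j. j < W \<and> f (N + j)} = {}" "{j. j < W \<and> f (n + j)} = {..<W}" using lo hi by auto
  then have "cnt N = 0" "cnt n = int W" unfolding cnt by (simp_all del: Collect_empty_eq)
  then have "\<exists>i. N \<le> i \<and> i \<le> n \<and> cnt i = int D"
    using step D assms(1) by (intro nat_intermed_int_val) auto
  then show ?thesis unfolding cnt by auto
qed

text \<open>In a window with a prescribed small number of points satisfying \<open>f\<close>, these
  points force many high values of the sampled sum, while its middle values are sampling errors and
  too rare for \<open>card_high_le_card_middle\<close>.\<close>

lemma no_sharp_threshold: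
  fixes K :: "'s \<Rightarrow> 's pmf" and g :: "'s \<Rightarrow> real" and f :: "nat \<Rightarrow> bool"
  assumes \<rho>: "\<rho> \<ge> 13"
  defines "R \<equiv> 2 ^ \<rho>" and "W \<equiv> 2 ^ (40 * \<rho>\<^sup>2)"
  defines "N \<equiv> (W * R ^ 3)\<^sup>2"
  assumes g: "\<And>x. 0 \<le> g x \<and> g x \<le> 1" and fin: "finite \<Omega>" and card: "128 * card \<Omega> \<le> R"
    and supp: "\<And>t. t < N \<Longrightarrow> set_pmf (bind_pmf \<mu> (steps K t)) \<subseteq> \<Omega>"
    and bimodal: "\<And>t. t < n + W \<Longrightarrow> f t \<Longrightarrow> measure_pmf.expectation (bind_pmf \<mu> (steps K t)) g \<ge> 9 / 10"
      "\<And>t. t < n + W \<Longrightarrow> \<not> f t \<Longrightarrow> measure_pmf.expectation (bind_pmf \<mu> (steps K t)) g \<le> 1 / 10"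
    and low: "\<And>t. t < N + W \<Longrightarrow> \<not> f t" and high: "\<And>t. n \<le> t \<Longrightarrow> t < n + W \<Longrightarrow> f t" and Nn: "N \<le> n"
  shows False
proof -
  \<comment> \<open>With this \<open>k\<close> the sampling error \<open>(1 / 2) ^ k\<close> is
    \<open>1 / R ^ 8\<close>, and \<open>5 * k\<close> periods of size at most \<open>R\<close> have
    product at most \<open>R ^ (5 * k) = W\<close>.\<close>
  define k where "k = 8 * \<rho>"
  have R0: "R > 0" and W0: "W > 0" unfolding R_def W_def by simp_all
  have WR: "W = R ^ (5 * k)"
    unfolding W_def R_def k_def by (simp add: power_mult[symmetric] power2_eq_square mult_ac)
  \<comment> \<open>This is \<open>W / (16 * R ^ 5)\<close>: small enough for the rarity hypothesis
    of \<open>card_high_le_card_middle\<close>, yet larger than the bound on the bad set by a factor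
    \<open>R ^ 3 / 16\<close>.\<close>
  define D where "D = R ^ (5 * k - 6) * 2 ^ (\<rho> - 4)"
  have D0: "D > 0" unfolding D_def R_def by simp
  have DW: "16 * R ^ 5 * D = W"
  proof -
    have "16 * R ^ 5 * D = R ^ 5 * R ^ (5 * k - 6) * (2 ^ 4 * 2 ^ (\<rho> - 4))" unfolding D_def by simp
    also have "2 ^ 4 * 2 ^ (\<rho> - 4) = R" unfolding R_def power_add[symmetric] using \<rho> by simp
    also have "R ^ 5 * R ^ (5 * k - 6) * R = R ^ (5 + (5 * k - 6) + 1)"
      by (simp only: power_add power_one_right)
    also have "5 + (5 * k - 6) + 1 = 5 * k" using \<rho> unfolding k_def by simp
    finally show ?thesis unfolding WR .
  qed
  have "D \<le> W" unfolding DW[symmetric] using R0 by simp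
  then obtain T where T: "N \<le> T" "T \<le> n" "card {j. j < W \<and> f (T + j)} = D"
    using ex_window_with_count[of N n W f D] Nn low high by auto
  have "\<exists>(w :: 's pmf) period v. (\<forall>y. 0 < period y \<and> period y \<le> R) \<and>
    (\<forall>y j. 0 \<le> v y j \<and> v y j \<le> (1::real)) \<and> (\<forall>y j. v y (j mod period y) = v y j) \<and>
    (\<forall>j<W. \<bar>measure_pmf.expectation (bind_pmf \<mu> (steps K (T + j))) g -
        measure_pmf.expectation w (\<lambda>y. v y j)\<bar> \<le> 1 / 20)"
    by (rule approx_periodic_mixture[where N = N and \<Omega> = \<Omega>])
       (rule g, rule fin, erule supp, rule card, rule R0, rule W0, simp only: N_def, rule T(1))
  then obtain w period v where per: "\<And>y. 0 < period y \<and> period y \<le> R"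
    and v: "\<And>y j. 0 \<le> v y j \<and> v y j \<le> (1::real)" and vper: "\<And>y j. v y (j mod period y) = v y j"
    and approx: "\<And>j. j < W \<Longrightarrow> \<bar>measure_pmf.expectation (bind_pmf \<mu> (steps K (T + j))) g -
        measure_pmf.expectation (w :: 's pmf) (\<lambda>y. v y j)\<bar> \<le> 1 / 20"
    by blast
  obtain ys where len: "length ys = 5 * k" and few: "real (card {j. j < W \<and>
      (measure_pmf.expectation w (\<lambda>y. v y j) \<le> 3 / 20 \<and> (\<Sum>y\<leftarrow>ys. v y j) \<ge> 2 * real k \<or>
       measure_pmf.expectation w (\<lambda>y. v y j) \<ge> 17 / 20 \<and> (\<Sum>y\<leftarrow>ys. v y j) \<le> 3 * real k)}) \<le> real W * (1 / 2) ^ k"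
    using ex_sample_few_bad[of v w k W, OF v] by blast
  define H where "H = (\<lambda>j. \<Sum>y\<leftarrow>ys. v y j)"
  define bad where "bad = {j. j < W \<and> (measure_pmf.expectation w (\<lambda>y. v y j) \<le> 3 / 20 \<and> H j \<ge> 2 * real k \<or>
       measure_pmf.expectation w (\<lambda>y. v y j) \<ge> 17 / 20 \<and> H j \<le> 3 * real k)}"
  have finbad: "finite bad" unfolding bad_def by simp
  have badle: "real (card bad) \<le> real W / real R ^ 8"
  proof -
    have "(1 / 2 :: real) ^ k = ((1 / 2) ^ \<rho>) ^ 8"
      unfolding k_def by (subst mult.commute) (rule power_mult)
    also have "\<dots> = 1 / real R ^ 8" unfolding R_def by (simp add: power_one_over)
    finally have "real W * (1 / 2) ^ k = real W / real R ^ 8" by simp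
    then show ?thesis using few unfolding bad_def H_def by (simp only:)
  qed
  have mean: "measure_pmf.expectation w (\<lambda>y. v y j) \<ge> 17 / 20" if "j < W" "f (T + j)" for j
  proof -
    have "measure_pmf.expectation (bind_pmf \<mu> (steps K (T + j))) g \<ge> 9 / 10"
      using that T(2) by (intro bimodal(1)) auto
    then show ?thesis using approx[OF that(1)] by linarith
  qed
  have mean': "measure_pmf.expectation w (\<lambda>y. v y j) \<le> 3 / 20" if "j < W" "\<not> f (T + j)" for j
  proof -
    have "measure_pmf.expectation (bind_pmf \<mu> (steps K (T + j))) g \<le> 1 / 10"
      using that T(2) by (intro bimodal(2)) auto
    then show ?thesis using approx[OF that(1)] by linarith
  qed
  define q where "q = prod_list (map period ys)"
  have q0: "q > 0" unfolding q_def using per by (induction ys) auto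
  have qW: "q \<le> W"
  proof -
    have "prod_list (map period zs) \<le> R ^ length zs" for zs
      using per by (induction zs) (auto intro!: mult_le_mono)
    then show ?thesis unfolding q_def WR len[symmetric] .
  qed
  have Hper: "H (j mod q) = H j" for j
  proof -
    have "v y (j mod q) = v y j" if "y \<in> set ys" for y
    proof -
      have "period y dvd q" unfolding q_def using that by (intro prod_list_dvd) auto
      then show ?thesis using vper[of y "j mod q"] vper[of y j] by (simp add: mod_mod_cancel)
    qed
    then show ?thesis unfolding H_def by (simp cong: map_cong)
  qed
  define hi where "hi = card {j. j < q \<and> H j > 3 * real k}"
  define mid where "mid = card {j. j < q \<and> 2 * real k \<le> H j \<and> H j \<le> 3 * real k}"
  \<comment> \<open>The window holds \<open>z\<close> full periods and is covered by
    \<open>z + 1\<close>; as \<open>z > 0\<close>, the two counts differ by a factor of at most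
    2.\<close>
  define z where "z = W div q"
  have zq: "z * q \<le> W" "W < (z + 1) * q" "z > 0"
    unfolding z_def using q0 qW dividend_less_div_times[of q W] by (auto simp: div_greater_zero_iff algebra_simps)
  \<comment> \<open>Each mean in the window is at most 3/20 or at least 17/20, so a middle value of
    \<open>H\<close> is always a sampling error.\<close>
  have mid_le: "z * mid \<le> card bad"
  proof -
    have "z * mid = card {j. j < z * q \<and> 2 * real k \<le> H j \<and> H j \<le> 3 * real k}"
      unfolding mid_def by (rule card_periodic_window[symmetric]) (simp add: Hper)
    also have "\<dots> \<le> card bad"
    proof (rule card_mono[OF finbad], rule subsetI)
      fix j assume j: "j \<in> {j. j < z * q \<and> 2 * real k \<le> H j \<and> H j \<le> 3 * real k}"
      then have "j < W" using zq(1) by auto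
      then show "j \<in> bad" using j mean[of j] mean'[of j] unfolding bad_def by auto
    qed
    finally show ?thesis .
  qed
  have hi_le: "z * hi \<le> D + card bad"
  proof -
    have "z * hi = card {j. j < z * q \<and> H j > 3 * real k}"
      unfolding hi_def by (rule card_periodic_window[symmetric]) (simp add: Hper)
    also have "\<dots> \<le> card ({j. j < W \<and> f (T + j)} \<union> bad)"
    proof (rule card_mono)
      show "{j. j < z * q \<and> H j > 3 * real k} \<subseteq> {j. j < W \<and> f (T + j)} \<union> bad"
      proof
        fix j assume j: "j \<in> {j. j < z * q \<and> H j > 3 * real k}"
        then have "j < W" using zq(1) by auto
        then show "j \<in> {j. j < W \<and> f (T + j)} \<union> bad"
          using j mean'[of j] unfolding bad_def by auto
      qed
    qed (use finbad in auto)
    also have "\<dots> \<le> D + card bad" unfolding T(3)[symmetric] by (rule card_Un_le)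
    finally show ?thesis .
  qed
  have "D \<le> (z + 1) * hi + card bad"
  proof -
    have "D \<le> card ({j. j < (z + 1) * q \<and> H j > 3 * real k} \<union> bad)"
      unfolding T(3)[symmetric]
    proof (rule card_mono)
      show "{j. j < W \<and> f (T + j)} \<subseteq> {j. j < (z + 1) * q \<and> H j > 3 * real k} \<union> bad"
      proof
        fix j assume j: "j \<in> {j. j < W \<and> f (T + j)}"
        then have "j < (z + 1) * q" using zq(2) by auto
        then show "j \<in> {j. j < (z + 1) * q \<and> H j > 3 * real k} \<union> bad"
          using j mean[of j] unfolding bad_def by auto
      qed
    qed (use finbad in auto)
    also have "\<dots> \<le> card {j. j < (z + 1) * q \<and> H j > 3 * real k} + card bad" by (rule card_Un_le)
    also have "card {j. j < (z + 1) * q \<and> H j > 3 * real k} = (z + 1) * hi"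
      unfolding hi_def by (rule card_periodic_window) (simp add: Hper)
    finally show ?thesis .
  qed
  also have "(z + 1) * hi \<le> 2 * (z * hi)" using zq(3) by (cases z) auto
  finally have D_le: "D \<le> 2 * (z * hi) + card bad" by simp
  have R8192: "R \<ge> 8192" unfolding R_def using power_increasing[OF \<rho>, of "2::nat"] by simp
  have bad_D: "card bad * R ^ 3 \<le> 16 * D"
  proof -
    have "real (card bad) * real R ^ 3 \<le> (real W / real R ^ 8) * real R ^ 3"
      by (intro mult_right_mono badle) simp
    also have "\<dots> = real W / real R ^ 5" using R0 by (simp add: field_simps power_add[symmetric])
    also have "\<dots> = 16 * real D" unfolding DW[symmetric] using R0 by simp
    finally have "real (card bad * R ^ 3) \<le> real (16 * D)" by simp
    then show ?thesis by (simp only: of_nat_le_iff)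
  qed
  have Rpow: "R ^ 3 \<ge> 8192 * R\<^sup>2" using R8192 mult_le_mono1[OF R8192, of "R\<^sup>2"] by (simp add: power3_eq_cube power2_eq_square)
  have "R\<^sup>2 \<ge> 1" using R0 by simp
  then have "R ^ 3 \<ge> 8192" using Rpow by linarith
  then have bad_small: "card bad * 512 \<le> D"
    using bad_D mult_le_mono2[of 8192 "R ^ 3" "card bad"] by linarith
  have rare: "2 * R ^ 5 * (hi + mid) \<le> q"
  proof -
    have "z * (2 * R ^ 5 * (hi + mid)) = 2 * R ^ 5 * (z * hi + z * mid)" by (simp add: algebra_simps)
    also have "\<dots> \<le> 2 * R ^ 5 * (2 * D)"
      using hi_le mid_le bad_small by (intro mult_le_mono2) linarith
    finally have "4 * (z * (2 * R ^ 5 * (hi + mid))) \<le> 4 * (2 * R ^ 5 * (2 * D))" by (rule mult_le_mono2)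
    also have "\<dots> = W" unfolding DW[symmetric] by simp
    also have "W \<le> 2 * (z * q)" using zq(2,3) by (cases z) auto
    finally have "z * (2 * R ^ 5 * (hi + mid)) \<le> z * q" by linarith
    then show ?thesis using zq(3) by simp
  qed
  obtain m where m: "2 ^ m \<le> q" "hi \<le> 2 * m * mid"
    using card_high_le_card_middle[where ys = ys and k = k and period = period and R = R and v = v]
      len per v vper R0 rare unfolding hi_def mid_def q_def H_def by blast
  have "(2::nat) ^ m \<le> 2 ^ (40 * \<rho>\<^sup>2)" using m(1) qW unfolding W_def by linarith
  then have m_le: "m \<le> 40 * \<rho>\<^sup>2" by simp
  have "\<rho> \<le> R" unfolding R_def by (simp add: less_imp_le)
  then have "\<rho>\<^sup>2 \<le> R\<^sup>2" by (intro power_mono) auto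
  then have mR: "m \<le> 40 * R\<^sup>2" using m_le by linarith
  \<comment> \<open>The comparison: \<open>D\<close> is at most \<open>4 * m + 1\<close> times the
    size of the bad set, with \<open>m\<close> at most \<open>40 * R\<^sup>2\<close>, while the bad
    set has at most \<open>16 * D / R ^ 3\<close> points. For \<open>R\<close> at least 8192 = 2 ^
    13 these are incompatible.\<close>
  have "D \<le> 2 * (z * hi) + card bad" by (rule D_le)
  also have "z * hi \<le> z * (2 * m * mid)" using m(2) by (rule mult_le_mono2)
  also have "\<dots> = 2 * m * (z * mid)" by simp
  also have "\<dots> \<le> 2 * m * card bad" using mid_le by (rule mult_le_mono2)
  finally have "D \<le> (4 * m + 1) * card bad" by (simp add: algebra_simps)
  also have "\<dots> \<le> (256 * R\<^sup>2) * card bad"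
    using mR \<open>R\<^sup>2 \<ge> 1\<close> by (intro mult_le_mono1) linarith
  finally have "32 * D \<le> 8192 * R\<^sup>2 * card bad" by (simp add: mult_ac)
  also have "\<dots> \<le> R ^ 3 * card bad" using Rpow by (rule mult_le_mono1)
  also have "\<dots> \<le> 16 * D" using bad_D by (simp add: mult.commute)
  finally show False using D0 by simp
qed

section \<open>From streaming algorithms to Markov chains\<close>

lemma memory_after_replicate:
  "memory_after A (replicate t x) = bind_pmf (init_memory A) (steps (\<lambda>m. update_memory A m x) t)"
proof (induction t)
  case (Suc t)
  have "memory_after A (replicate (Suc t) x) = bind_pmf (memory_after A (replicate t x)) (\<lambda>m. update_memory A m x)"
    unfolding memory_after_def by (simp add: replicate_append_same[symmetric] del: replicate_append_same)
  also have "\<dots> = bind_pmf (init_memory A) (steps (\<lambda>m. update_memory A m x) (t + 1))"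
    unfolding Suc bind_steps_add[symmetric] by (simp add: steps_Suc_0 del: steps.simps)
  finally show ?case by (simp only: Suc_eq_plus1)
qed (simp add: memory_after_def steps_0 bind_return_pmf')

lemma length_bound_of_count_approximation:
  fixes A :: "'a streaming_algorithm" and c :: real
  assumes c: "c > 1"
    and pd: "pseudo_deterministic A (streams_upto ((c + 1) * real n))"
    and ac: "approximates_count A (streams_upto ((c + 1) * real n)) c"
    and us: "uses_space A (streams_upto ((c + 1) * real n)) s"
  shows "real n < c\<^sup>2 * 2 ^ (81 * (s + 13)\<^sup>2)"
proof (rule ccontr)
  assume "\<not> ?thesis"
  then have big: "c\<^sup>2 * 2 ^ (81 * (s + 13)\<^sup>2) \<le> real n" by simp
  \<comment> \<open>There are fewer than \<open>2 ^ (s + 1)\<close> memory states, and 128 times as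
    many is at most \<open>2 ^ \<rho>\<close>; the offset 13 also ensures
    \<open>\<rho> \<ge> 13\<close>.\<close>
  define \<rho> where "\<rho> = s + 13"
  define R :: nat where "R = 2 ^ \<rho>"
  define W :: nat where "W = 2 ^ (40 * \<rho>\<^sup>2)"
  define N where "N = (W * R ^ 3)\<^sup>2"
  \<comment> \<open>\<open>N\<close> is \<open>2 ^ (80 * \<rho>\<^sup>2 + 6 * \<rho>)\<close>; since
    \<open>\<rho> \<ge> 13\<close>, one more \<open>\<rho>\<^sup>2\<close> absorbs
    \<open>6 * \<rho> + 1\<close>.\<close>
  have "N + W \<le> 2 ^ (81 * \<rho>\<^sup>2)"
  proof -
    have N: "N = 2 ^ (80 * \<rho>\<^sup>2 + 6 * \<rho>)"
      unfolding N_def W_def R_def by (simp add: power_add power_mult_distrib power_mult[symmetric] mult_ac)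
    have "W \<le> N" unfolding N W_def by (intro power_increasing) auto
    then have "N + W \<le> 2 ^ (80 * \<rho>\<^sup>2 + 6 * \<rho> + 1)" unfolding N by simp
    also have "\<dots> \<le> 2 ^ (81 * \<rho>\<^sup>2)"
    proof (rule power_increasing)
      have "13 * \<rho> \<le> \<rho>\<^sup>2" unfolding power2_eq_square \<rho>_def by (rule mult_le_mono1) simp
      moreover have "13 \<le> \<rho>" unfolding \<rho>_def by simp
      ultimately show "80 * \<rho>\<^sup>2 + 6 * \<rho> + 1 \<le> 81 * \<rho>\<^sup>2" by linarith
    qed simp
    finally show ?thesis .
  qed
  then have "real (N + W) \<le> real (2 ^ (81 * \<rho>\<^sup>2))" by (simp only: of_nat_le_iff)
  then have "c\<^sup>2 * real (N + W) \<le> c\<^sup>2 * 2 ^ (81 * (s + 13)\<^sup>2)"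
    unfolding \<rho>_def by (intro mult_left_mono) auto
  then have NW: "c\<^sup>2 * real (N + W) \<le> real n" using big by linarith
  have "1 * real (N + W) \<le> c\<^sup>2 * real (N + W)" using c by (intro mult_right_mono) auto
  from order.trans[OF this NW] have "real (N + W) \<le> real n" by (simp only: mult_1)
  then have NWn: "N + W \<le> n" by (simp only: of_nat_le_iff)
  define D :: "'a list set" where "D = streams_upto ((c + 1) * real n)"
  obtain F where F: "\<And>\<sigma>. \<sigma> \<in> D \<Longrightarrow> measure_pmf.prob (output_of A \<sigma>) {F \<sigma>} \<ge> 9 / 10"
    using pd unfolding pseudo_deterministic_def D_def by blast
  have within: "within_factor c (real (length \<sigma>)) (F \<sigma>)" if "\<sigma> \<in> D" for \<sigma>
    using approximates_count_iff_canonical[of D A F c] F ac that unfolding D_def by blast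
  define \<sigma> :: "nat \<Rightarrow> 'a list" where "\<sigma> = (\<lambda>t. replicate t undefined)"
  \<comment> \<open>The windows reach beyond \<open>n\<close> but stay admissible, because
    \<open>n + W \<le> 2 * n \<le> (c + 1) * n\<close>.\<close>
  have \<sigma>D: "\<sigma> t \<in> D" if "t < n + W" for t
  proof -
    have "real t \<le> 2 * real n" using that NWn by linarith
    also have "\<dots> \<le> (c + 1) * real n" using c by (intro mult_right_mono) auto
    finally show ?thesis unfolding D_def streams_upto_def \<sigma>_def by simp
  qed
  \<comment> \<open>The cut \<open>n / c\<close> separates the canonical outputs: for
    \<open>t < N + W\<close> items they are at most \<open>c * t\<close>, below the cut since
    \<open>c\<^sup>2 * (N + W) \<le> n\<close>; for \<open>t \<ge> n\<close> items they are at least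
    \<open>t / c\<close>.\<close>
  define S where "S = {y. real n / c \<le> y}"
  define f where "f = (\<lambda>t. F (\<sigma> t) \<in> S)"
  define g where "g = (\<lambda>m. measure_pmf.prob (read_output A m) S)"
  define K where "K = (\<lambda>m. update_memory A m undefined)"
  have mem: "memory_after A (\<sigma> t) = bind_pmf (init_memory A) (steps K t)" for t
    unfolding \<sigma>_def K_def by (rule memory_after_replicate)
  have Eg: "measure_pmf.expectation (bind_pmf (init_memory A) (steps K t)) g = measure_pmf.prob (output_of A (\<sigma> t)) S" for t
  proof -
    have "measure_pmf.prob (output_of A (\<sigma> t)) S = measure_pmf.expectation (output_of A (\<sigma> t)) (indicator S)" by simp
    also have "\<dots> = measure_pmf.expectation (memory_after A (\<sigma> t)) g"
      unfolding output_of_def by (subst expectation_bind_pmf_unit) (auto simp: g_def)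
    finally show ?thesis unfolding mem by simp
  qed
  show False
  proof (rule no_sharp_threshold[of \<rho> g "{m. length m \<le> s}" "init_memory A" K n f])
    show "\<rho> \<ge> 13" unfolding \<rho>_def by simp
    show "0 \<le> g x \<and> g x \<le> 1" for x unfolding g_def by simp
    have lists: "{m :: bool list. length m \<le> s} = {m. set m \<subseteq> UNIV \<and> length m \<le> s}" by simp
    show "finite {m :: bool list. length m \<le> s}" unfolding lists by (rule finite_lists_length_le) simp
    have "card {m :: bool list. length m \<le> s} = (\<Sum>i\<le>s. 2 ^ i)"
      unfolding lists by (subst card_lists_length_le) auto
    also have "\<dots> = 2 ^ Suc s - 1" by (simp add: sum_power2 lessThan_Suc_atMost[symmetric] atLeast0LessThan[symmetric] del: sum.op_ivl_Suc power_Suc)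
    finally have "128 * card {m :: bool list. length m \<le> s} \<le> 128 * 2 ^ Suc s" by simp
    also have "\<dots> \<le> 2 ^ \<rho>" unfolding \<rho>_def by (simp add: power_add)
    finally show "128 * card {m :: bool list. length m \<le> s} \<le> 2 ^ \<rho>" .
    show "set_pmf (bind_pmf (init_memory A) (steps K t)) \<subseteq> {m. length m \<le> s}"
      if "t < (2 ^ (40 * \<rho>\<^sup>2) * (2 ^ \<rho>) ^ 3)\<^sup>2" for t
    proof -
      have "t < n + W" using that NWn unfolding N_def W_def R_def by linarith
      then show ?thesis using us \<sigma>D[of t] unfolding uses_space_def mem[symmetric] D_def by auto
    qed
    show "measure_pmf.expectation (bind_pmf (init_memory A) (steps K t)) g \<ge> 9 / 10"
      if t: "t < n + 2 ^ (40 * \<rho>\<^sup>2)" and f: "f t" for t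
    proof -
      have "9 / 10 \<le> measure_pmf.prob (output_of A (\<sigma> t)) {F (\<sigma> t)}"
        using t by (intro F \<sigma>D) (simp add: W_def)
      also have "\<dots> \<le> measure_pmf.prob (output_of A (\<sigma> t)) S"
        using f unfolding f_def by (intro measure_pmf.finite_measure_mono) auto
      finally show ?thesis unfolding Eg .
    qed
    show "measure_pmf.expectation (bind_pmf (init_memory A) (steps K t)) g \<le> 1 / 10"
      if t: "t < n + 2 ^ (40 * \<rho>\<^sup>2)" and f: "\<not> f t" for t
    proof -
      have "9 / 10 \<le> measure_pmf.prob (output_of A (\<sigma> t)) {F (\<sigma> t)}"
        using t by (intro F \<sigma>D) (simp add: W_def)
      also have "\<dots> \<le> measure_pmf.prob (output_of A (\<sigma> t)) (- S)"
        using f unfolding f_def by (intro measure_pmf.finite_measure_mono) auto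
      also have "\<dots> = 1 - measure_pmf.prob (output_of A (\<sigma> t)) S"
        using measure_pmf.prob_compl[of S "output_of A (\<sigma> t)"] by (simp add: Compl_eq_Diff_UNIV)
      finally show ?thesis unfolding Eg by simp
    qed
    show "\<not> f t" if "t < (2 ^ (40 * \<rho>\<^sup>2) * (2 ^ \<rho>) ^ 3)\<^sup>2 + 2 ^ (40 * \<rho>\<^sup>2)" for t
    proof -
      have t: "t < N + W" using that unfolding N_def W_def R_def .
      then have "F (\<sigma> t) \<le> c * real t"
        using within[OF \<sigma>D[of t]] NWn unfolding within_factor_def \<sigma>_def by simp
      moreover have "c * real t < real n / c"
      proof -
        have "c\<^sup>2 * real t < c\<^sup>2 * real (N + W)" using t c by (intro mult_strict_left_mono) auto
        then have "c\<^sup>2 * real t < real n" using NW by linarith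
        then show ?thesis using c by (simp add: field_simps power2_eq_square)
      qed
      ultimately show ?thesis unfolding f_def S_def by simp
    qed
    show "f t" if "n \<le> t" "t < n + 2 ^ (40 * \<rho>\<^sup>2)" for t
    proof -
      have "real t / c \<le> F (\<sigma> t)"
        using within[OF \<sigma>D[of t]] that unfolding within_factor_def \<sigma>_def W_def by simp
      moreover have "real n / c \<le> real t / c" using that c by (intro divide_right_mono) auto
      ultimately show ?thesis unfolding f_def S_def by simp
    qed
    show "(2 ^ (40 * \<rho>\<^sup>2) * (2 ^ \<rho>) ^ 3)\<^sup>2 \<le> n" using NWn unfolding N_def W_def R_def by linarith
  qed
qed

text \<open>Without memory the empty stream and a one-item stream have the same output law, hence
  the same canonical output; but it must be 0 for the first and positive for the second. Positivity
  later allows \<open>s + 13 \<le> 14 * s\<close>.\<close>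

lemma space_pos_of_count_approximation:
  fixes A :: "'a streaming_algorithm" and c :: real
  assumes c: "c > 1" and n: "n > 1"
    and pd: "pseudo_deterministic A (streams_upto ((c + 1) * real n))"
    and ac: "approximates_count A (streams_upto ((c + 1) * real n)) c"
    and us: "uses_space A (streams_upto ((c + 1) * real n)) s"
  shows "s > 0"
proof (rule ccontr)
  assume "\<not> s > 0"
  define D :: "'a list set" where "D = streams_upto ((c + 1) * real n)"
  obtain F where F: "\<And>\<sigma>. \<sigma> \<in> D \<Longrightarrow> measure_pmf.prob (output_of A \<sigma>) {F \<sigma>} \<ge> 9 / 10"
    using pd unfolding pseudo_deterministic_def D_def by blast
  have within: "within_factor c (real (length \<sigma>)) (F \<sigma>)" if "\<sigma> \<in> D" for \<sigma>
    using approximates_count_iff_canonical[of D A F c] F ac that unfolding D_def by blast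
  have "1 * 1 \<le> (c + 1) * real n" using c n by (intro mult_mono) auto
  then have D01: "[] \<in> D" "[undefined] \<in> D" unfolding D_def streams_upto_def by auto
  have "memory_after A \<sigma> = return_pmf []" if "\<sigma> \<in> D" for \<sigma>
    using us that \<open>\<not> s > 0\<close> unfolding uses_space_def D_def[symmetric]
    by (auto simp: set_pmf_subset_singleton[symmetric])
  then have eq: "output_of A [undefined] = output_of A []" unfolding output_of_def using D01 by simp
  have "F [undefined] = F []"
  proof (rule ccontr)
    assume ne: "F [undefined] \<noteq> F []"
    have "measure_pmf.prob (output_of A []) ({F []} \<union> {F [undefined]}) =
        measure_pmf.prob (output_of A []) {F []} + measure_pmf.prob (output_of A []) {F [undefined]}"
      using ne by (intro measure_pmf.finite_measure_Union) auto
    moreover have "measure_pmf.prob (output_of A []) ({F []} \<union> {F [undefined]}) \<le> 1" by simp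
    ultimately show False using F[OF D01(1)] F[OF D01(2)] unfolding eq by linarith
  qed
  moreover have "F [] = 0" using within[OF D01(1)] unfolding within_factor_def by simp
  moreover have "F [undefined] > 0"
    using within[OF D01(2)] c unfolding within_factor_def by (simp add: less_le_trans[of 0 "1 / c"])
  ultimately show False by simp
qed

theorem theorem1p2:
  "\<exists>\<alpha>::real. \<alpha> > 0 \<and> (\<exists>d::nat. \<forall>(c::real) (n::nat) (A :: 'a streaming_algorithm) (s::nat).
     c > 1 \<and> n > 1 \<and>
     pseudo_deterministic A (streams_upto ((c + 1) * real n)) \<and>
     approximates_count A (streams_upto ((c + 1) * real n)) c \<and>
     uses_space A (streams_upto ((c + 1) * real n)) s
     \<longrightarrow> real s \<ge> \<alpha> / c ^ d * sqrt (log 2 (real n) / log 2 (log 2 (real n))))"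
proof (intro exI[of _ "1 / 300"] conjI exI[of _ 1] allI impI)
  fix c :: real and n :: nat and A :: "'a streaming_algorithm" and s :: nat
  assume "c > 1 \<and> n > 1 \<and>
     pseudo_deterministic A (streams_upto ((c + 1) * real n)) \<and>
     approximates_count A (streams_upto ((c + 1) * real n)) c \<and>
     uses_space A (streams_upto ((c + 1) * real n)) s"
  then have c: "c > 1" and n: "n > 1" and s: "s > 0" and bound: "real n < c\<^sup>2 * 2 ^ (81 * (s + 13)\<^sup>2)"
    using space_pos_of_count_approximation length_bound_of_count_approximation by blast+
  show "real s \<ge> 1 / 300 / c ^ 1 * sqrt (log 2 (real n) / log 2 (log 2 (real n)))"
  \<comment> \<open>For \<open>n = 2\<close> the iterated logarithm is 0, and division by zero makes
    the right-hand side 0.\<close>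
  proof (cases "n = 2")
    case False
    have "log 2 (real n) < log 2 (c\<^sup>2 * 2 ^ (81 * (s + 13)\<^sup>2))" using bound n c by (subst log_less_cancel_iff) auto
    also have "\<dots> = 2 * log 2 c + real (81 * (s + 13)\<^sup>2)"
      using c by (simp add: log_mult log_nat_power)
    \<comment> \<open>Here 15876 is 81 * 14 ^ 2, and the term in \<open>log 2 c\<close> is absorbed
      because \<open>c \<le> c * real s\<close> and \<open>c * real s > 1\<close>.\<close>
    also have "\<dots> \<le> 4 * (c * real s)\<^sup>2 + 15876 * (c * real s)\<^sup>2"
    proof (rule add_mono)
      have "ln c \<le> c" using ln_bound[of c] c by simp
      also have "c \<le> c * (2 * ln 2)" using ln2_ge_two_thirds c mult_left_mono[of 1 "2 * ln 2" c] by simp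
      finally have "log 2 c \<le> 2 * c" unfolding log_def by (simp add: divide_le_eq mult_ac)
      also have "2 * c \<le> 2 * (c * real s)\<^sup>2"
      proof -
        have "c \<le> c * real s" using s c by simp
        moreover from this have "1 * (c * real s) \<le> (c * real s) * (c * real s)"
          using c by (intro mult_right_mono) linarith+
        ultimately show ?thesis by (simp add: power2_eq_square)
      qed
      finally show "2 * log 2 c \<le> 4 * (c * real s)\<^sup>2" by simp
      have "s + 13 \<le> 14 * s" using s by simp
      then have "(s + 13)\<^sup>2 \<le> (14 * s)\<^sup>2" by (rule power_mono) simp
      then have "81 * (s + 13)\<^sup>2 \<le> 15876 * s\<^sup>2" by (simp add: power_mult_distrib)
      then have "real (81 * (s + 13)\<^sup>2) \<le> real (15876 * s\<^sup>2)" by (simp only: of_nat_le_iff)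
      also have "\<dots> = 15876 * (1 * (real s)\<^sup>2)" by simp
      also have "\<dots> \<le> 15876 * (c\<^sup>2 * (real s)\<^sup>2)" using c by (intro mult_left_mono mult_right_mono) auto
      finally show "real (81 * (s + 13)\<^sup>2) \<le> 15876 * (c * real s)\<^sup>2" by (simp add: power_mult_distrib)
    qed
    finally have log_n: "log 2 (real n) \<le> 15880 * (c * real s)\<^sup>2" by simp
    have n3: "n \<ge> 3" using n False by simp
    have log_n_ge: "log 2 (real n) \<ge> 3 / 2"
    proof -
      have "((2::real) powr (3 / 2))\<^sup>2 \<le> 3\<^sup>2" by (simp add: power2_eq_square powr_add[symmetric])
      then have "(2::real) powr (3 / 2) \<le> 3" by (rule power2_le_imp_le) simp
      then have "2 powr (3 / 2) \<le> real n" using n3 by linarith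
      then show ?thesis using n by (subst le_log_iff) auto
    qed
    \<comment> \<open>Since \<open>2 \<le> (3 / 2) ^ 3\<close>, the bound 3/2 on the logarithm gives
      1/3 here. Dividing by the iterated logarithm thus at most triples the estimate, and 3 * 15880
      is below 300 ^ 2.\<close>
    have loglog: "log 2 (log 2 (real n)) \<ge> 1 / 3"
    proof -
      have "((2::real) powr (1 / 3)) ^ 3 \<le> (3 / 2) ^ 3"
        by (simp add: power3_eq_cube powr_add[symmetric])
      then have "(2::real) powr (1 / 3) \<le> 3 / 2" by (subst (asm) power_mono_iff) auto
      then have "2 powr (1 / 3) \<le> log 2 (real n)" using log_n_ge by linarith
      then show ?thesis using log_n_ge by (subst le_log_iff) auto
    qed
    have "log 2 (real n) / log 2 (log 2 (real n)) \<le> log 2 (real n) / (1 / 3)"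
      using log_n_ge loglog by (intro divide_left_mono) auto
    also have "\<dots> \<le> 90000 * (c * real s)\<^sup>2"
    proof -
      have "l / (1 / 3) \<le> 90000 * u" if "l \<le> 15880 * u" "0 \<le> u" for l u :: real using that by simp
      from this[OF log_n] show ?thesis by simp
    qed
    also have "\<dots> = (300 * (c * real s))\<^sup>2" by (simp add: power_mult_distrib)
    finally have "sqrt (log 2 (real n) / log 2 (log 2 (real n))) \<le> 300 * (c * real s)"
      using c by (intro real_le_lsqrt) auto
    then show ?thesis using c by (simp add: field_simps)
  qed simp
qed simp

end
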